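(* Let $T_j$ be the $j$-twist knot for each positive integer $j$, and let $c_1,\dots,c_m\in\mathbb{Z}$. If the linear combination $\#_{j=1}^m c_jT_j$ is rationally algebraically slice, then $c_jT_j$ is rationally algebraically slice for each $j=1,\dots,m$.
   Context: $T_n$ is the $n$-twist knot ($T_1$ the figure-eight knot, $T_2$ the stevedore knot), which has Seifert matrix $\begin{pmatrix}-1&1\\0&n\end{pmatrix}$ and Alexander polynomial $nt^2-(2n+1)t+n$. For $c\in\mathbb{Z}$ and a knot $K$, $cK$ is the connected sum of $|c|$ copies of $K$ (if $c\ge0$) or of its concordance inverse (if $c<0$). Alexander polynomials are normalized to lie in $\mathbb{Z}[t]$ with non-zero constant term. Levine's invariants. An algebraic number $z$ is reciprocal if $z$ and $z^{-1}$ are roots of the same irreducible polynomial over $\mathbb{Q}$; let $\varphi_z$ be that polynomial. For a knot $K$: if $z$ is reciprocal with $|z|=1$, $s_z(K)\in\mathbb{Z}$ is the jump of the Tristram–Levine signature function of $K$ at $z$; if $z$ is reciprocal, $e_z(K)\in\mathbb{Z}/2\mathbb{Z}$ is the mod 2 multiplicity of $\varphi_z$ as a factor of $\Delta_K$; and $d_z(K)\in \mathbb{Q}(z+z^{-1})^\times/\{u\overline{u}: u\in\mathbb{Q}(z)^\times\}$ (with $\overline{\cdot}$ the involution $z\mapsto z^{-1}$) is the discriminant of the $z$-primary part of a Seifert matrix of $K$. Explicitly: let $A$ be a nonsingular rational matrix that is $S$-equivalent over $\mathbb{Q}$ to a Seifert matrix of $K$, with symmetric form $\beta=A+A^T$ and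 isometry $t=A^{-1}A^T$; the $\varphi_z(t)$-primary part of this isometric structure is Witt equivalent to one annihilated by $\varphi_z(t)$, which is a $\mathbb{Q}(z)$-vector space of some dimension $r$ ($t$ acting as $z$) with a unique nonsingular Hermitian form $H$ such that $\beta=\mathrm{Tr}_{\mathbb{Q}(z)/\mathbb{Q}}\circ H$; put $d_z(K)=(-1)^{r(r-1)/2}\det H$. All three invariants are trivial when $\Delta_K$ is relatively prime to $\varphi_z$; $s_z$ and $e_z$ are additive under connected sum, and $d_z(K\#J)=(-1)^{e_z(K)e_z(J)}d_z(K)d_z(J)$. Rational version (Cha). Let $P$ be the set of sequences $(a_k)_{k\ge1}$ of reciprocal numbers with $(a_{nk})^n=a_k$ for all $n,k\geq 1$, and $P_0\subset P$ the subset of sequences with $|a_k|=1$ for all $k$. For $a\in P_0$ and $b\in P$ put $s_a(K)=(s_{a_k}(K))_{k\ge1}$, $e_b(K)=(e_{b_k}(K))_{k\ge1}$, $d_b(K)=(d_{b_k}(K))_{k\ge1}$. These form a complete set of invariants of rational algebraic concordance: $K$ is rationally algebraically slice if and only if $s_a(K)$ is trivial for all $a\in P_0$ and $e_b(K)$, $d_b(K)$ are trivial for all $b\in P$. *)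

theory Defs
  imports Complex_Main "HOL-Computational_Algebra.Computational_Algebra" "HOL-Computational_Algebra.Field_as_Ring"
    "Jordan_Normal_Form.Char_Poly"
begin

text \<open>
  Knots enter through Seifert matrices.  Every invariant below depends only on the S-equivalence
  class of a Seifert matrix, which is determined by the knot.  A connected sum has the block sum
  of Seifert matrices as a Seifert matrix, the concordance inverse (the reversed mirror image) of
  a knot with Seifert matrix \<open>V\<close> has Seifert matrix \<open>- V\<close>, and the unknot has the empty one.
\<close>

definition twist_knot :: "nat \<Rightarrow> int mat" where
  "twist_knot n = mat_of_rows_list 2 [[-1, 1], [0, int n]]"

definition connected_sum :: "int mat list \<Rightarrow> int mat" where
  "connected_sum Vs = diag_block_mat Vs"

definition concordance_inverse :: "int mat \<Rightarrow> int mat" where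
  "concordance_inverse V = - V"

definition knot_multiple :: "int \<Rightarrow> int mat \<Rightarrow> int mat" where
  "knot_multiple c V =
     (if c \<ge> 0 then connected_sum (replicate (nat c) V)
      else connected_sum (replicate (nat (- c)) (concordance_inverse V)))"

text \<open>Dividing by a power of \<open>t\<close> makes the constant term non-zero; the sign remains that of the
  determinant.\<close>

definition alexander_poly :: "int mat \<Rightarrow> int poly" where
  "alexander_poly V =
     (let p = det (map_mat (\<lambda>x. [:x:]) V - [:0, 1:] \<cdot>\<^sub>m map_mat (\<lambda>x. [:x:]) (transpose_mat V))
      in p div monom 1 (order 0 p))"

lemma det_dim2: "A \<in> carrier_mat 2 2 \<Longrightarrow>
    det A = A $$ (0, 0) * A $$ (1, 1) - A $$ (0, 1) * A $$ (1, 0)" for A :: "'a::comm_ring_1 mat"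
proof -
  assume A: "A \<in> carrier_mat 2 2"
  have "det A = (\<Sum>i<2. A $$ (i, 0) * cofactor A i 0)"
    by (rule laplace_expansion_column[OF A]) simp
  also have "\<dots> = A $$ (0, 0) * cofactor A 0 0 + A $$ (1, 0) * cofactor A 1 0"
    by (simp add: lessThan_nat_numeral lessThan_Suc)
  also have "cofactor A 0 0 = A $$ (1, 1)"
    using A by (simp add: cofactor_def mat_delete_def det_single)
  also have "cofactor A 1 0 = - A $$ (0, 1)"
    using A by (simp add: cofactor_def mat_delete_def det_single)
  finally show ?thesis by (simp add: mult.commute)
qed

lemma alexander_poly_twist_knot:
  assumes "n \<ge> 1"
  shows "alexander_poly (twist_knot n) = - [:int n, - (2 * int n + 1), int n:]"
proof -
  let ?M = "map_mat (\<lambda>x. [:x:]) (twist_knot n)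
            - [:0, 1:] \<cdot>\<^sub>m map_mat (\<lambda>x. [:x:]) (transpose_mat (twist_knot n))"
  have carr: "?M \<in> carrier_mat 2 2"
    by (rule carrier_matI) (simp_all add: twist_knot_def mat_of_rows_list_def)
  have entries: "?M $$ (0, 0) = [:-1, 1:]" "?M $$ (0, 1) = [:1:]"
    "?M $$ (1, 0) = [:0, -1:]" "?M $$ (1, 1) = [:int n, - int n:]"
    by (simp_all add: twist_knot_def mat_of_rows_list_def)
  have p: "det ?M = - [:int n, - (2 * int n + 1), int n:]"
    unfolding det_dim2[OF carr] entries by simp
  have "poly (- [:int n, - (2 * int n + 1), int n:]) 0 \<noteq> 0"
    using assms by simp
  then have "order 0 (- [:int n, - (2 * int n + 1), int n:]) = 0"
    by (rule order_0I)
  then show ?thesis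
    unfolding alexander_poly_def Let_def p by (simp only: monom_eq_1 div_by_1)
qed


subsection \<open>Reciprocal numbers and their number fields\<close>

abbreviation rpoly :: "rat poly \<Rightarrow> complex \<Rightarrow> complex" where
  "rpoly p x \<equiv> poly (map_poly of_rat p) x"

text \<open>The condition \<open>z \<noteq> 0\<close> is needed since \<open>inverse 0 = 0\<close>.\<close>

definition reciprocal :: "complex \<Rightarrow> bool" where
  "reciprocal z \<longleftrightarrow> z \<noteq> 0 \<and> (\<exists>p. irreducible p \<and> rpoly p z = 0 \<and> rpoly p (inverse z) = 0)"

definition min_poly :: "complex \<Rightarrow> rat poly" where
  "min_poly z = (THE p. irreducible p \<and> lead_coeff p = 1 \<and> rpoly p z = 0)"

definition number_field :: "complex \<Rightarrow> complex set" where
  "number_field z = range (\<lambda>p. rpoly p z)"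

definition involution :: "complex \<Rightarrow> complex \<Rightarrow> complex" where
  "involution z u = (THE v. \<exists>p. u = rpoly p z \<and> v = rpoly p (inverse z))"

text \<open>The field trace is the sum over all embeddings of \<open>number_field z\<close> into the complex
  numbers; these correspond to the roots of \<open>min_poly z\<close>.\<close>

definition field_trace :: "complex \<Rightarrow> complex \<Rightarrow> rat" where
  "field_trace z u =
     (THE q. \<exists>p. u = rpoly p z \<and> of_rat q = (\<Sum>w | rpoly (min_poly z) w = 0. rpoly p w))"

definition norm_group :: "complex \<Rightarrow> complex set" where
  "norm_group z = {u * involution z u | u. u \<in> number_field z \<and> u \<noteq> 0}"


subsection \<open>Signature jump and multiplicity invariants\<close>

definition hermitian_signature :: "complex mat \<Rightarrow> int" where
  "hermitian_signature H =
     (\<Sum>x | x > 0 \<and> eigenvalue H (complex_of_real x). int (order (complex_of_real x) (char_poly H)))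
   - (\<Sum>x | x < 0 \<and> eigenvalue H (complex_of_real x). int (order (complex_of_real x) (char_poly H)))"

definition signature_function :: "int mat \<Rightarrow> complex \<Rightarrow> int" where
  "signature_function V w =
     hermitian_signature ((1 - w) \<cdot>\<^sub>m map_mat of_int V + (1 - cnj w) \<cdot>\<^sub>m map_mat of_int (transpose_mat V))"

definition s_inv :: "int mat \<Rightarrow> complex \<Rightarrow> int" where
  "s_inv V z = Lim (at_right 0) (\<lambda>x. signature_function V (z * cis x))
             - Lim (at_left 0) (\<lambda>x. signature_function V (z * cis x))"

definition e_inv :: "int mat \<Rightarrow> complex \<Rightarrow> nat" where
  "e_inv V z = multiplicity (min_poly z) (map_poly of_int (alexander_poly V)) mod 2"


subsection \<open>S-equivalence over the rationals\<close>

inductive s_move :: "rat mat \<Rightarrow> rat mat \<Rightarrow> bool" where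
  congruence: "A \<in> carrier_mat n n \<Longrightarrow> P \<in> carrier_mat n n \<Longrightarrow> invertible_mat P \<Longrightarrow>
    s_move A (transpose_mat P * A * P)"
| col_enlargement: "A \<in> carrier_mat n n \<Longrightarrow> x \<in> carrier_vec n \<Longrightarrow>
    s_move A (four_block_mat A (mat_of_cols n [x, 0\<^sub>v n])
                             (0\<^sub>m 2 n) (mat_of_rows_list 2 [[0, 1], [0, 0]]))"
| row_enlargement: "A \<in> carrier_mat n n \<Longrightarrow> x \<in> carrier_vec n \<Longrightarrow>
    s_move A (four_block_mat A (0\<^sub>m n 2)
                             (mat_of_rows n [x, 0\<^sub>v n]) (mat_of_rows_list 2 [[0, 0], [1, 0]]))"

definition s_equivalent :: "rat mat \<Rightarrow> rat mat \<Rightarrow> bool" where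
  "s_equivalent = equivclp s_move"


subsection \<open>Rational isometric structures\<close>

text \<open>A pair \<open>(B, T)\<close> of matrices stands for the space \<open>carrier_vec n\<close> with the nonsingular
  symmetric form \<open>B\<close> and the isometry \<open>T\<close>.\<close>

definition isometric_structure :: "nat \<Rightarrow> rat mat \<Rightarrow> rat mat \<Rightarrow> bool" where
  "isometric_structure n B T \<longleftrightarrow>
     B \<in> carrier_mat n n \<and> T \<in> carrier_mat n n \<and> transpose_mat B = B \<and> det B \<noteq> 0 \<and>
     transpose_mat T * B * T = B"

definition mat_poly :: "rat poly \<Rightarrow> rat mat \<Rightarrow> rat mat" where
  "mat_poly p T = mat (dim_row T) (dim_row T) (\<lambda>(i, j). \<Sum>k\<le>degree p. coeff p k * (T ^\<^sub>m k) $$ (i, j))"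

text \<open>A subspace is given by a matrix whose columns form a basis of it.\<close>

definition injective_mat :: "rat mat \<Rightarrow> bool" where
  "injective_mat P \<longleftrightarrow>
     (\<forall>x \<in> carrier_vec (dim_col P). P *\<^sub>v x = 0\<^sub>v (dim_row P) \<longrightarrow> x = 0\<^sub>v (dim_col P))"

text \<open>\<open>P\<close> spans a \<open>T\<close>-invariant subspace of half the dimension on which \<open>B\<close> vanishes.\<close>

definition metabolic :: "rat mat \<Rightarrow> rat mat \<Rightarrow> bool" where
  "metabolic B T \<longleftrightarrow>
     (\<exists>m P S. B \<in> carrier_mat (2 * m) (2 * m) \<and> P \<in> carrier_mat (2 * m) m \<and> S \<in> carrier_mat m m \<and>
        injective_mat P \<and> transpose_mat P * B * P = 0\<^sub>m m m \<and> T * P = P * S)"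

definition witt_equivalent :: "rat mat \<Rightarrow> rat mat \<Rightarrow> rat mat \<Rightarrow> rat mat \<Rightarrow> bool" where
  "witt_equivalent B T B' T' \<longleftrightarrow> metabolic (diag_block_mat [B, - B']) (diag_block_mat [T, T'])"

text \<open>\<open>(B', T')\<close> is the \<open>p(T)\<close>-primary part of \<open>(B, T)\<close>, written in the basis formed by the columns
  of \<open>P\<close>.\<close>

definition primary_part :: "rat poly \<Rightarrow> rat mat \<Rightarrow> rat mat \<Rightarrow> rat mat \<Rightarrow> rat mat \<Rightarrow> bool" where
  "primary_part p B T B' T' \<longleftrightarrow>
     (\<exists>n k P. B \<in> carrier_mat n n \<and> T \<in> carrier_mat n n \<and> P \<in> carrier_mat n k \<and> T' \<in> carrier_mat k k \<and>
        injective_mat P \<and>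
        {P *\<^sub>v x | x. x \<in> carrier_vec k} =
          {v \<in> carrier_vec n. \<exists>e. (mat_poly p T ^\<^sub>m e) *\<^sub>v v = 0\<^sub>v n} \<and>
        T * P = P * T' \<and> B' = transpose_mat P * B * P)"

text \<open>
  The map \<open>f\<close> identifies the rational space \<open>carrier_vec n\<close> with the \<open>r\<close>-dimensional vector space
  over \<open>number_field z\<close>, with \<open>T\<close> acting as multiplication by \<open>z\<close> (additivity makes \<open>f\<close> linear over
  the rationals), and \<open>h\<close> is the Gram matrix of the Hermitian form \<open>H\<close> whose trace is \<open>B\<close>.
\<close>

definition hermitian_lift :: "complex \<Rightarrow> nat \<Rightarrow> rat mat \<Rightarrow> rat mat \<Rightarrow> nat \<Rightarrow> complex mat \<Rightarrow> bool" where
  "hermitian_lift z n B T r h \<longleftrightarrow>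
     h \<in> carrier_mat r r \<and> det h \<noteq> 0 \<and>
     (\<forall>i<r. \<forall>j<r. h $$ (i, j) \<in> number_field z \<and> h $$ (i, j) = involution z (h $$ (j, i))) \<and>
     (\<exists>f. bij_betw f (carrier_vec n) {x \<in> carrier_vec r. \<forall>i<r. x $ i \<in> number_field z} \<and>
        (\<forall>v \<in> carrier_vec n. \<forall>w \<in> carrier_vec n. f (v + w) = f v + f w) \<and>
        (\<forall>v \<in> carrier_vec n. f (T *\<^sub>v v) = z \<cdot>\<^sub>v f v) \<and>
        (\<forall>v \<in> carrier_vec n. \<forall>w \<in> carrier_vec n.
           scalar_prod v (B *\<^sub>v w) = field_trace z (scalar_prod (f v) (h *\<^sub>v map_vec (involution z) (f w)))))"


subsection \<open>The discriminant invariant\<close>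

text \<open>\<open>A * T = transpose_mat A\<close> says that \<open>T\<close> is the inverse of \<open>A\<close> times its transpose.\<close>

definition discriminant_of :: "int mat \<Rightarrow> complex \<Rightarrow> complex \<Rightarrow> bool" where
  "discriminant_of V z \<delta> \<longleftrightarrow>
     (\<exists>n A T B\<^sub>0 T\<^sub>0 N B\<^sub>1 T\<^sub>1 r h.
        A \<in> carrier_mat n n \<and> det A \<noteq> 0 \<and> s_equivalent (map_mat of_int V) A \<and>
        T \<in> carrier_mat n n \<and> A * T = transpose_mat A \<and>
        primary_part (min_poly z) (A + transpose_mat A) T B\<^sub>0 T\<^sub>0 \<and>
        isometric_structure N B\<^sub>1 T\<^sub>1 \<and> witt_equivalent B\<^sub>0 T\<^sub>0 B\<^sub>1 T\<^sub>1 \<and>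
        mat_poly (min_poly z) T\<^sub>1 = 0\<^sub>m N N \<and>
        hermitian_lift z N B\<^sub>1 T\<^sub>1 r h \<and>
        \<delta> = (-1) ^ (r * (r - 1) div 2) * det h)"

text \<open>
  The value of \<open>d_inv\<close> is a coset of \<open>norm_group z\<close>: all admissible choices above give determinants
  which differ by norms (and which lie in \<open>number_field (z + inverse z)\<close>, being fixed by the
  involution).  The trivial coset is \<open>norm_group z\<close> itself.
\<close>

definition d_inv :: "int mat \<Rightarrow> complex \<Rightarrow> complex set" where
  "d_inv V z = {\<delta> * u | \<delta> u. discriminant_of V z \<delta> \<and> u \<in> norm_group z}"


subsection \<open>Rational algebraic sliceness\<close>

text \<open>Sequences are indexed by \<open>k \<ge> 1\<close>; the value at \<open>0\<close> is irrelevant.\<close>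

definition P_seq :: "(nat \<Rightarrow> complex) set" where
  "P_seq = {a. (\<forall>k\<ge>1. reciprocal (a k)) \<and> (\<forall>n\<ge>1. \<forall>k\<ge>1. a (n * k) ^ n = a k)}"

definition P0_seq :: "(nat \<Rightarrow> complex) set" where
  "P0_seq = {a \<in> P_seq. \<forall>k\<ge>1. cmod (a k) = 1}"

definition rationally_algebraically_slice :: "int mat \<Rightarrow> bool" where
  "rationally_algebraically_slice V \<longleftrightarrow>
     (\<forall>a \<in> P0_seq. \<forall>k\<ge>1. s_inv V (a k) = 0) \<and>
     (\<forall>b \<in> P_seq. \<forall>k\<ge>1. e_inv V (b k) = 0 \<and> d_inv V (b k) = norm_group (b k))"

end

theory Submission
  imports Defs
begin

text \<open>
  The Alexander polynomial of \<open>T\<^sub>n\<close> has roots with \<open>z + 1/z = 2 + 1/n\<close>, so a reciprocal number \<open>z\<close> is a root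
  for at most one \<open>n\<close>.  Split the sum as \<open>X + V + Y\<close> with \<open>V = c\<^sub>j T\<^sub>j\<close>.  The signature jumps of twist knots
  vanish because the roots are not on the unit circle, and multiplicities are additive.  For the
  discriminants, fix for \<open>X\<close> and \<open>Y\<close> explicit ones at \<open>z\<close>, coming from Hermitian forms of ranks \<open>a\<close> and \<open>b\<close>;
  triviality of the multiplicity of the sum makes \<open>a + b\<close> even.  By additivity, multiplying any
  discriminant of \<open>V\<close> by a fixed \<open>\<kappa>\<close> yields a discriminant of the sum, hence a norm; and \<open>\<kappa>\<close> is a norm
  because either \<open>V\<close> or both \<open>X\<close> and \<open>Y\<close> have a trivial \<open>z\<close>-primary part.
\<close>

subsection \<open>The field generated by a reciprocal number\<close>

text \<open>The obstacle is that \<open>d_inv\<close> gathers the discriminants of all admissible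
  choices. That they form one coset would take the Witt theory of Hermitian forms, so only the
  constructive direction is used: choices for two summands combine into a choice for their block
  sum. The hypothesis says that every value so produced is a norm. This reaches even an arbitrary
  discriminant of V, of unspecified rank r, because r enters only through the sign (-1)^(r (a + b)).
  Such a choice is considered at every reciprocal z, so the trace must be rational and additive in
  general and not only in the quadratic fields of twist knots. Existence of a discriminant is needed
  only for explicit choices: a constant Hermitian form of rank 1 on Q(z) if z is a root, and the
  empty form otherwise. The value 2 + 1/n comes from dividing n t^2 - (2 n + 1) t + n by n t. For
  the jumps, the signature function is shown to vanish at every w.\<close>

interpretation of_rat_poly: map_poly_inj_idom_hom of_rat ..

lemmas rpoly_simps = of_rat_poly.hom_add of_rat_poly.hom_mult of_rat_poly.hom_minus of_rat_poly.hom_uminus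
  of_rat_poly.hom_sum of_rat_hom.map_poly_pCons_hom

text \<open>If p did not divide q, both would be coprime, and a Bezout identity a p + b q = 1
  evaluated at the common root z would read 0 = 1.\<close>

lemma irreducible_dvd_iff_rpoly_eq_0:
  assumes "irreducible p" and "rpoly p z = 0"
  shows "p dvd q \<longleftrightarrow> rpoly q z = 0"
proof
  assume "p dvd q"
  then show "rpoly q z = 0" using assms by (auto simp: rpoly_simps elim!: dvdE)
next
  assume q: "rpoly q z = 0"
  show "p dvd q"
  proof (rule ccontr)
    assume "\<not> p dvd q"
    then have "coprime p q"
      using assms(1) by (intro prime_elem_imp_coprime) (simp_all add: prime_elem_iff_irreducible)
    then obtain a b where ab: "a * p + b * q = 1"
      using bezout_coefficients_fst_snd[of p q] by auto
    have "rpoly (a * p + b * q) z = 0" using q assms(2) by (simp add: rpoly_simps)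
    then show False unfolding ab by simp
  qed
qed

context
  fixes z :: complex
  assumes z: "reciprocal z"
begin

lemma reciprocal_nonzero: "z \<noteq> 0"
  using z by (simp add: reciprocal_def)

text \<open>Justifies the definite description: the polynomial provided by reciprocity is made
  monic, and two monic irreducible polynomials with the root z divide each other.\<close>

lemma min_poly_props:
  "irreducible (min_poly z) \<and> lead_coeff (min_poly z) = 1 \<and> rpoly (min_poly z) z = 0"
proof -
  obtain p where p: "irreducible p" "rpoly p z = 0" using z by (auto simp: reciprocal_def)
  define q where "q = Polynomial.smult (inverse (lead_coeff p)) p"
  have lc: "lead_coeff p \<noteq> 0" using p(1) by auto
  have q: "irreducible q \<and> lead_coeff q = 1 \<and> rpoly q z = 0"
    using p lc irreducible_mult_unit_left[of "[:inverse (lead_coeff p):]" p]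
    by (simp add: q_def of_rat_hom.map_poly_hom_smult is_unit_triv)
  show ?thesis unfolding min_poly_def
  proof (rule theI[where a = q])
    show "irreducible q \<and> lead_coeff q = 1 \<and> rpoly q z = 0" by (fact q)
  next
    fix r assume r: "irreducible r \<and> lead_coeff r = 1 \<and> rpoly r z = 0"
    have "r dvd q" "q dvd r"
      using q r irreducible_dvd_iff_rpoly_eq_0 by blast+
    then show "r = q" using q r
      by (metis poly_dvd_antisym)
  qed
qed

lemma min_poly_irreducible: "irreducible (min_poly z)"
  and min_poly_monic: "lead_coeff (min_poly z) = 1"
  and min_poly_root: "rpoly (min_poly z) z = 0"
  using min_poly_props by auto

lemma min_poly_prime_elem: "prime_elem (min_poly z)"
  using min_poly_irreducible by (simp add: prime_elem_iff_irreducible)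

lemma min_poly_dvd_iff: "min_poly z dvd p \<longleftrightarrow> rpoly p z = 0"
  using irreducible_dvd_iff_rpoly_eq_0[OF min_poly_irreducible min_poly_root] .

lemma rpoly_eq_0_conjugate:
  assumes "rpoly p z = 0" and "rpoly (min_poly z) w = 0"
  shows "rpoly p w = 0"
  using assms by (auto simp: min_poly_dvd_iff[symmetric] rpoly_simps elim!: dvdE)

text \<open>The embedding of \<open>number_field z\<close> that sends z to a conjugate w is well
  defined. The definite descriptions in \<open>involution\<close> (where w = 1/z) and in
  \<open>field_trace\<close> rest on this.\<close>

lemma rpoly_eq_conjugate:
  assumes "rpoly p z = rpoly q z" and "rpoly (min_poly z) w = 0"
  shows "rpoly p w = rpoly q w"
  using rpoly_eq_0_conjugate[of "p - q" w] assms by (simp add: rpoly_simps)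

text \<open>The polynomial that witnesses reciprocity divides \<open>min_poly z\<close> and hands
  down its root 1/z.\<close>

lemma min_poly_root_inverse: "rpoly (min_poly z) (inverse z) = 0"
proof -
  obtain p where p: "irreducible p" "rpoly p z = 0" "rpoly p (inverse z) = 0"
    using z by (auto simp: reciprocal_def)
  have "p dvd min_poly z" using irreducible_dvd_iff_rpoly_eq_0[OF p(1,2)] min_poly_root by simp
  then show ?thesis using p(3) by (auto simp: rpoly_simps elim!: dvdE)
qed

lemma involution_rpoly: "involution z (rpoly p z) = rpoly p (inverse z)"
  unfolding involution_def
  by (rule the_equality) (auto dest: rpoly_eq_conjugate[OF _ min_poly_root_inverse])

lemma number_fieldI: "rpoly p z \<in> number_field z"
  by (auto simp: number_field_def)

lemma number_fieldE:
  assumes "u \<in> number_field z" obtains p where "u = rpoly p z"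
  using assms by (auto simp: number_field_def)

lemma number_field_0 [simp]: "0 \<in> number_field z"
  using number_fieldI[of 0] by simp

lemma number_field_1 [simp]: "1 \<in> number_field z"
  using number_fieldI[of 1] by simp

lemma number_field_add: "u \<in> number_field z \<Longrightarrow> v \<in> number_field z \<Longrightarrow> u + v \<in> number_field z"
  using number_fieldI[of "_ + _"] by (auto simp: rpoly_simps elim!: number_fieldE)

lemma number_field_mult: "u \<in> number_field z \<Longrightarrow> v \<in> number_field z \<Longrightarrow> u * v \<in> number_field z"
  using number_fieldI[of "_ * _"] by (auto simp: rpoly_simps elim!: number_fieldE)

lemma number_field_sum: "(\<And>i. i \<in> I \<Longrightarrow> g i \<in> number_field z) \<Longrightarrow> sum g I \<in> number_field z"
  by (induction I rule: infinite_finite_induct) (auto intro: number_field_add)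

text \<open>In a Bezout identity a f + b q = 1 with f = \<open>min_poly z\<close>, the value b(z) is
  the inverse of q(z).\<close>

lemma number_field_inverse:
  assumes "u \<in> number_field z" and "u \<noteq> 0"
  shows "inverse u \<in> number_field z"
proof -
  obtain q where u: "u = rpoly q z" using assms(1) by (rule number_fieldE)
  then have "\<not> min_poly z dvd q" using assms(2) by (simp add: min_poly_dvd_iff)
  then have "coprime (min_poly z) q" by (intro prime_elem_imp_coprime min_poly_prime_elem)
  then obtain a b where ab: "a * min_poly z + b * q = 1"
    using bezout_coefficients_fst_snd[of "min_poly z" q] by auto
  have "rpoly (a * min_poly z + b * q) z = rpoly b z * u"
    by (simp add: rpoly_simps min_poly_root u)
  then have "rpoly b z * u = 1" unfolding ab by simp
  then have "inverse u = rpoly b z" by (metis inverse_unique mult.commute)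
  then show ?thesis using number_fieldI by simp
qed

lemma involution_in_number_field:
  assumes "u \<in> number_field z" shows "involution z u \<in> number_field z"
proof -
  obtain p where u: "u = rpoly p z" using assms by (rule number_fieldE)
  have "inverse z \<in> number_field z"
    using number_field_inverse[of z] number_fieldI[of "[:0, 1:]"] reciprocal_nonzero
    by (simp add: rpoly_simps)
  then have "rpoly q (inverse z) \<in> number_field z" for q
    by (induction q)
      (auto simp: rpoly_simps intro!: number_field_add number_field_mult
         number_fieldI[of "[:_:]", simplified rpoly_simps, simplified])
  then show ?thesis by (simp add: u involution_rpoly)
qed

lemma involution_0 [simp]: "involution z 0 = 0"
  using involution_rpoly[of 0] by simp

lemma involution_1 [simp]: "involution z 1 = 1"
  using involution_rpoly[of 1] by simp

lemma involution_mult: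
  "u \<in> number_field z \<Longrightarrow> v \<in> number_field z \<Longrightarrow> involution z (u * v) = involution z u * involution z v"
  using involution_rpoly[of "_ * _"] by (auto simp: rpoly_simps involution_rpoly elim!: number_fieldE)

lemma one_in_norm_group: "1 \<in> norm_group z"
  unfolding norm_group_def by (force intro: exI[of _ 1])

text \<open>The involution is multiplicative, so it sends u and its inverse to two numbers with
  product 1; the conjugate of a nonzero u is therefore nonzero.\<close>

lemma norm_group_nonzero: assumes "x \<in> norm_group z" shows "x \<noteq> 0"
proof -
  obtain u where u: "x = u * involution z u" "u \<in> number_field z" "u \<noteq> 0"
    using assms by (auto simp: norm_group_def)
  have "involution z u * involution z (inverse u) = 1"
    using involution_mult[OF u(2) number_field_inverse[OF u(2,3)]] u(3) by simp
  then show ?thesis using u by auto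
qed

lemma norm_group_mult:
  assumes "x \<in> norm_group z" "y \<in> norm_group z" shows "x * y \<in> norm_group z"
proof -
  obtain u v where "x = u * involution z u" "u \<in> number_field z" "u \<noteq> 0"
    "y = v * involution z v" "v \<in> number_field z" "v \<noteq> 0"
    using assms by (auto simp: norm_group_def)
  then show ?thesis unfolding norm_group_def
    by (auto simp: involution_mult intro!: exI[of _ "u * v"] number_field_mult)
qed

lemma norm_group_divide:
  assumes "x \<in> norm_group z" "y \<in> norm_group z" shows "x / y \<in> norm_group z"
proof -
  obtain v where v: "y = v * involution z v" "v \<in> number_field z" "v \<noteq> 0"
    using assms(2) by (auto simp: norm_group_def)
  have "involution z v * involution z (inverse v) = 1"
    using involution_mult[OF v(2) number_field_inverse[OF v(2,3)]] v(3) by simp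
  then have "inverse y = inverse v * involution z (inverse v)"
    using inverse_unique[of "involution z v"] by (simp add: v(1))
  then have "inverse y \<in> norm_group z"
    unfolding norm_group_def using v by (auto intro!: number_field_inverse)
  from norm_group_mult[OF assms(1) this] show ?thesis by (simp add: divide_inverse)
qed

end

text \<open>By Lagrange interpolation at the roots \<open>w\<close> of \<open>f = min_poly z\<close>, the remainder of
  \<open>p * f'\<close> modulo \<open>f\<close> is the sum of the polynomials \<open>p(w) f(X) / (X - w)\<close>, so its top coefficient
  is the sum of all \<open>p(w)\<close>.\<close>

lemma sum_over_conjugates_rational:
  assumes "irreducible f" and "lead_coeff f = 1"
  shows "\<exists>q. of_rat q = (\<Sum>w | rpoly f w = 0. rpoly p w)"
proof -
  define F :: "complex poly" where "F = map_poly of_rat f"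
  define S where "S = {w. poly F w = 0}"
  define Q where "Q w = (\<Prod>u\<in>S - {w}. [:- u, 1:])" for w
  define g where "g = (p * pderiv f) mod f"
  define G where "G = (\<Sum>w\<in>S. Polynomial.smult (rpoly p w) (Q w))"
  have deg: "degree f > 0"
    using assms(1) by (metis gr0I irreducibleD' irreducible_def is_unit_iff_degree)
  have "F \<noteq> 0" using deg by (auto simp: F_def)
  then have fin: "finite S" unfolding S_def by (rule poly_roots_finite)
  have dF: "pderiv F = map_poly of_rat (pderiv f)"
    by (simp add: F_def of_rat_hom.map_poly_pderiv)
  \<comment> \<open>A common root of F and its derivative would make f divide
    \<open>pderiv f\<close>, which is nonzero and of smaller degree.\<close>
  have "rsquarefree F"
    unfolding rsquarefree_roots
  proof (intro allI notI, elim conjE)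
    fix a assume a: "poly F a = 0" "poly (pderiv F) a = 0"
    have "rpoly f a = 0" using a by (simp add: F_def)
    from irreducible_dvd_iff_rpoly_eq_0[OF assms(1) this] have "f dvd pderiv f"
      using a(2) by (simp only: dF)
    then show False using deg by simp
  qed
  then have F: "F = (\<Prod>w\<in>S. [:- w, 1:])"
    using complex_poly_decompose_rsquarefree[of F] assms(2) by (simp add: S_def F_def)
  have "degree F = card S"
    unfolding F by (subst degree_prod_sum_eq) auto
  then have card: "card S = degree f" by (simp add: F_def)
  have degQ: "degree (Q w) = degree f - 1" if "w \<in> S" for w
    unfolding Q_def using that fin card by (subst degree_prod_sum_eq) auto
  have topQ: "coeff (Q w) (degree f - 1) = 1" if "w \<in> S" for w
  proof -
    have "lead_coeff (Q w) = 1" unfolding Q_def by (simp add: lead_coeff_prod)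
    then show ?thesis using degQ[OF that] by simp
  qed
  have Q_other: "poly (Q w) u = 0" if "u \<in> S" "w \<noteq> u" for u w
    using that fin unfolding Q_def poly_prod by (auto simp: prod_zero_iff)
  \<comment> \<open>In the product rule for the derivative of F, only the term that omits the factor
    X - u survives at u.\<close>
  have diff: "poly (pderiv F) u = poly (Q u) u" if u: "u \<in> S" for u
  proof -
    have "pderiv F = (\<Sum>w\<in>S. Q w)"
      by (subst F) (simp add: pderiv_prod pderiv_pCons Q_def)
    then have "poly (pderiv F) u = (\<Sum>w\<in>S. if w = u then poly (Q u) u else 0)"
      using u by (auto simp: poly_sum Q_other intro!: sum.cong)
    then show ?thesis using u fin by simp
  qed
  have degg: "degree g < degree f"
    using degree_mod_less[of f "p * pderiv f"] deg unfolding g_def by force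
  have degG: "degree G \<le> degree f - 1"
    unfolding G_def using degQ by (intro degree_sum_le fin) (auto intro: order_trans[OF degree_smult_le])
  have "map_poly of_rat g = G"
  proof (rule ccontr)
    \<comment> \<open>Both polynomials have degree below that of f and agree at its distinct roots,
      as many as the degree of f, so their difference would have too many roots.\<close>
    let ?D = "map_poly of_rat g - G"
    assume "map_poly of_rat g \<noteq> G"
    then have D: "?D \<noteq> 0" by simp
    have "poly ?D u = 0" if u: "u \<in> S" for u
    proof -
      have "p * pderiv f = (p * pderiv f) div f * f + g" unfolding g_def by simp
      then have "rpoly (p * pderiv f) u = rpoly ((p * pderiv f) div f * f + g) u" by simp
      then have "rpoly g u = rpoly p u * poly (pderiv F) u"
        using u by (simp add: rpoly_simps dF) (simp add: S_def F_def)
      moreover have "poly G u = (\<Sum>w\<in>S. if w = u then rpoly p u * poly (Q u) u else 0)"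
        unfolding G_def poly_sum using u by (auto simp: Q_other intro!: sum.cong)
      ultimately show ?thesis using u fin by (simp add: diff)
    qed
    then have "card S \<le> card {u. poly ?D u = 0}"
      using poly_roots_finite[OF D] by (intro card_mono) auto
    also have "\<dots> \<le> degree ?D" by (rule card_poly_roots_bound[OF D])
    also have "\<dots> < degree f"
      using degg degG deg by (intro degree_diff_less) auto
    finally show False using card by simp
  qed
  moreover have "coeff G (degree f - 1) = (\<Sum>w\<in>S. rpoly p w)"
    unfolding G_def coeff_sum using topQ by (intro sum.cong) auto
  ultimately have "of_rat (coeff g (degree f - 1)) = (\<Sum>w\<in>S. rpoly p w)"
    by (simp flip: of_rat_hom.coeff_map_poly_hom)
  then show ?thesis by (auto simp: S_def F_def)
qed

section \<open>The field trace\<close>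

context
  fixes z :: complex
  assumes z: "reciprocal z"
begin

text \<open>Summing over conjugates gives a rational number, and that number depends only on the
  value at z and not on the polynomial p representing it, so the definite description is
  met.\<close>

lemma of_rat_field_trace:
  "of_rat (field_trace z (rpoly p z)) = (\<Sum>w | rpoly (min_poly z) w = 0. rpoly p w)"
proof -
  obtain q where q: "of_rat q = (\<Sum>w | rpoly (min_poly z) w = 0. rpoly p w)"
    using sum_over_conjugates_rational[OF min_poly_irreducible min_poly_monic] z by blast
  have "(\<Sum>w | rpoly (min_poly z) w = 0. rpoly p' w) = (\<Sum>w | rpoly (min_poly z) w = 0. rpoly p w)"
    if "rpoly p z = rpoly p' z" for p'
    using rpoly_eq_conjugate[OF z that] by (intro sum.cong) auto
  note conj = this
  have "field_trace z (rpoly p z) = q"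
    unfolding field_trace_def
  proof (intro the_equality)
    fix q' assume "\<exists>p'. rpoly p z = rpoly p' z \<and> of_rat q' = (\<Sum>w | rpoly (min_poly z) w = 0. rpoly p' w)"
    then obtain p' where p': "rpoly p z = rpoly p' z"
      "of_rat q' = (\<Sum>w | rpoly (min_poly z) w = 0. rpoly p' w)" by blast
    have "(of_rat q' :: complex) = of_rat q" unfolding p'(2) q by (rule conj[OF p'(1)])
    then show "q' = q" by simp
  qed (use q in blast)
  then show ?thesis using q by simp
qed

lemma field_trace_add:
  assumes "u \<in> number_field z" "v \<in> number_field z"
  shows "field_trace z (u + v) = field_trace z u + field_trace z v"
proof -
  obtain p q where pq: "u = rpoly p z" "v = rpoly q z"
    using assms by (metis number_fieldE z)
  have "(of_rat (field_trace z (rpoly (p + q) z)) :: complex)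
      = of_rat (field_trace z u + field_trace z v)"
    unfolding pq of_rat_add of_rat_field_trace by (simp add: rpoly_simps sum.distrib)
  then show ?thesis by (simp add: pq rpoly_simps)
qed

lemma field_trace_0: "field_trace z 0 = 0"
  using field_trace_add[of 0 0] z by (simp add: number_field_0)

end


subsection \<open>Block sums\<close>

text \<open>Binary form of \<open>diag_block_mat\<close>. It is used for rectangular blocks too,
  namely for matrices whose columns span subspaces.\<close>

definition dsum :: "'a::zero mat \<Rightarrow> 'a mat \<Rightarrow> 'a mat" (infixr \<open>\<boxplus>\<close> 66) where
  "A \<boxplus> B = four_block_mat A (0\<^sub>m (dim_row A) (dim_col B)) (0\<^sub>m (dim_row B) (dim_col A)) B"

lemma dsum_carrier [simp, intro]:
  "A \<in> carrier_mat a b \<Longrightarrow> B \<in> carrier_mat c d \<Longrightarrow> A \<boxplus> B \<in> carrier_mat (a + c) (b + d)"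
  by (simp add: dsum_def)

lemma dim_dsum [simp]:
  "dim_row (A \<boxplus> B) = dim_row A + dim_row B" "dim_col (A \<boxplus> B) = dim_col A + dim_col B"
  by (simp_all add: dsum_def)

lemma index_dsum:
  "i < dim_row A + dim_row B \<Longrightarrow> j < dim_col A + dim_col B \<Longrightarrow>
   (A \<boxplus> B) $$ (i, j) =
     (if i < dim_row A then if j < dim_col A then A $$ (i, j) else 0
      else if j < dim_col A then 0 else B $$ (i - dim_row A, j - dim_col A))"
  by (simp add: dsum_def)

lemma dsum_assoc: "(A \<boxplus> B) \<boxplus> C = A \<boxplus> (B \<boxplus> C)"
  using assoc_four_block_mat[of A B C] by (simp add: dsum_def)

lemma dsum_empty [simp]: "0\<^sub>m 0 0 \<boxplus> A = A" "A \<boxplus> 0\<^sub>m 0 0 = A"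
  by (auto simp: index_dsum intro!: eq_matI)

lemma transpose_dsum: "transpose_mat (A \<boxplus> B) = transpose_mat A \<boxplus> transpose_mat B"
  by (auto simp: index_dsum intro!: eq_matI)

lemma map_mat_dsum: "f 0 = 0 \<Longrightarrow> map_mat f (A \<boxplus> B) = map_mat f A \<boxplus> map_mat f B"
  by (auto simp: index_dsum intro!: eq_matI)

lemma uminus_dsum: "- (A \<boxplus> B) = (- A) \<boxplus> (- B :: 'a::group_add mat)"
  by (auto simp: index_dsum intro!: eq_matI)

lemma smult_dsum: "c \<cdot>\<^sub>m (A \<boxplus> B) = (c \<cdot>\<^sub>m A) \<boxplus> (c \<cdot>\<^sub>m B :: 'a::semiring_0 mat)"
  by (auto simp: index_dsum intro!: eq_matI)

lemma add_dsum:
  assumes "dim_row A = dim_row C" "dim_col A = dim_col C" "dim_row B = dim_row D" "dim_col B = dim_col D"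
  shows "(A \<boxplus> B) + (C \<boxplus> D) = (A + C) \<boxplus> (B + D :: 'a::monoid_add mat)"
  using assms by (auto simp: index_dsum intro!: eq_matI)

lemma minus_dsum:
  assumes "dim_row A = dim_row C" "dim_col A = dim_col C" "dim_row B = dim_row D" "dim_col B = dim_col D"
  shows "(A \<boxplus> B) - (C \<boxplus> D) = (A - C) \<boxplus> (B - D :: 'a::group_add mat)"
  using assms by (auto simp: index_dsum intro!: eq_matI)

lemma dsum_zero: "0\<^sub>m a b \<boxplus> 0\<^sub>m c d = 0\<^sub>m (a + c) (b + d)"
  by (auto simp: index_dsum intro!: eq_matI)

lemma dsum_one: "1\<^sub>m a \<boxplus> 1\<^sub>m b = 1\<^sub>m (a + b)"
  by (auto simp: index_dsum intro!: eq_matI)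

lemma mult_dsum:
  assumes "A \<in> carrier_mat a b" "C \<in> carrier_mat b c" "B \<in> carrier_mat a' b'" "D \<in> carrier_mat b' c'"
  shows "(A \<boxplus> B) * (C \<boxplus> D) = A * C \<boxplus> (B * D :: 'a::comm_ring_1 mat)"
  unfolding dsum_def using assms
  by (subst mult_four_block_mat[of _ a b _ b' _ a' _ _ c _ c']) (auto)

lemma mult_vec_dsum:
  assumes "A \<in> carrier_mat a b" "B \<in> carrier_mat c d" "v \<in> carrier_vec b" "w \<in> carrier_vec d"
  shows "(A \<boxplus> B) *\<^sub>v (v @\<^sub>v w) = A *\<^sub>v v @\<^sub>v (B *\<^sub>v w :: 'a::comm_ring_1 vec)"
  unfolding dsum_def using assms
  by (subst four_block_mat_mult_vec[of _ a b _ d _ c]) auto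

lemma pow_dsum:
  assumes "A \<in> carrier_mat a a" "B \<in> carrier_mat b b"
  shows "(A \<boxplus> B) ^\<^sub>m k = A ^\<^sub>m k \<boxplus> (B ^\<^sub>m k :: 'a::comm_ring_1 mat)"
  using assms
  by (induction k) (auto simp: dsum_one mult_dsum[OF pow_carrier_mat _ pow_carrier_mat])

lemma det_dsum:
  assumes "A \<in> carrier_mat a a" "B \<in> carrier_mat b b"
  shows "det (A \<boxplus> B) = det A * det (B :: 'a::idom mat)"
  unfolding dsum_def using assms by (intro det_four_block_mat_lower_left_zero) auto

lemma diag_block_mat_Cons_dsum: "diag_block_mat (A # As) = A \<boxplus> diag_block_mat As"
  by (simp add: dsum_def Let_def)

lemma diag_block_mat_append_dsum: "diag_block_mat (As @ Bs) = diag_block_mat As \<boxplus> diag_block_mat Bs"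
  by (simp add: dsum_def Let_def Matrix.diag_block_mat_append)

declare diag_block_mat.simps(2) [simp del]


subsection \<open>Polynomials in a matrix\<close>

lemma mat_poly_carrier [simp, intro]: "T \<in> carrier_mat n n \<Longrightarrow> mat_poly p T \<in> carrier_mat n n"
  by (auto simp: mat_poly_def)

lemma dim_mat_poly [simp]: "dim_row (mat_poly p T) = dim_row T" "dim_col (mat_poly p T) = dim_row T"
  by (simp_all add: mat_poly_def)

lemma index_mat_poly:
  assumes "T \<in> carrier_mat n n" "i < n" "j < n" "degree p \<le> N"
  shows "mat_poly p T $$ (i, j) = (\<Sum>k\<le>N. coeff p k * (T ^\<^sub>m k) $$ (i, j))"
proof -
  have "mat_poly p T $$ (i, j) = (\<Sum>k\<le>degree p. coeff p k * (T ^\<^sub>m k) $$ (i, j))"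
    using assms by (auto simp: mat_poly_def)
  also have "\<dots> = (\<Sum>k\<le>N. coeff p k * (T ^\<^sub>m k) $$ (i, j))"
    using assms(4) by (intro sum.mono_neutral_left) (auto simp: coeff_eq_0)
  finally show ?thesis .
qed

lemma mat_poly_add:
  assumes T: "T \<in> carrier_mat n n"
  shows "mat_poly (p + q) T = mat_poly p T + mat_poly q T"
proof (rule eq_matI)
  fix i j assume "i < dim_row (mat_poly p T + mat_poly q T)" "j < dim_col (mat_poly p T + mat_poly q T)"
  then have ij: "i < n" "j < n" using T by (auto simp: mat_poly_def)
  let ?N = "max (degree p) (degree q)"
  show "mat_poly (p + q) T $$ (i, j) = (mat_poly p T + mat_poly q T) $$ (i, j)"
    using ij T degree_add_le_max[of p q]
    by (simp add: index_mat_poly[OF T ij, of _ ?N] distrib_right sum.distrib)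
qed (use T in \<open>auto simp: mat_poly_def\<close>)

text \<open>Horner's rule turns the entrywise definition into a recursion, which opens the way to
  induction on polynomials.\<close>

lemma mat_poly_pCons:
  assumes T: "T \<in> carrier_mat n n"
  shows "mat_poly (pCons a p) T = a \<cdot>\<^sub>m 1\<^sub>m n + mat_poly p T * T"
proof (rule eq_matI)
  fix i j assume "i < dim_row (a \<cdot>\<^sub>m 1\<^sub>m n + mat_poly p T * T)" "j < dim_col (a \<cdot>\<^sub>m 1\<^sub>m n + mat_poly p T * T)"
  then have ij: "i < n" "j < n" using T by auto
  have "(mat_poly p T * T) $$ (i, j) = (\<Sum>l<n. (\<Sum>k\<le>degree p. coeff p k * (T ^\<^sub>m k) $$ (i, l)) * T $$ (l, j))"
    using ij T
    by (auto simp: scalar_prod_def index_mat_poly[OF T, of _ _ _ "degree p"] atLeast0LessThan intro!: sum.cong)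
  also have "\<dots> = (\<Sum>k\<le>degree p. coeff p k * (\<Sum>l<n. (T ^\<^sub>m k) $$ (i, l) * T $$ (l, j)))"
    by (simp add: sum_distrib_left sum_distrib_right mult.assoc) (rule sum.swap)
  also have "\<dots> = (\<Sum>k\<le>degree p. coeff p k * (T ^\<^sub>m Suc k) $$ (i, j))"
    using ij T pow_carrier_mat[OF T] by (auto simp: scalar_prod_def atLeast0LessThan intro!: sum.cong)
  finally show "mat_poly (pCons a p) T $$ (i, j) = (a \<cdot>\<^sub>m 1\<^sub>m n + mat_poly p T * T) $$ (i, j)"
    using ij T
    by (simp add: index_mat_poly[OF T, of _ _ _ "Suc (degree p)"] degree_pCons_le sum.atMost_Suc_shift
        del: pow_mat.simps(2) sum.atMost_Suc)
qed (use T in \<open>auto simp: mat_poly_def\<close>)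

lemma mat_poly_0: "T \<in> carrier_mat n n \<Longrightarrow> mat_poly 0 T = 0\<^sub>m n n"
  by (auto simp: mat_poly_def)

lemma mat_poly_1: "T \<in> carrier_mat n n \<Longrightarrow> mat_poly 1 T = 1\<^sub>m n"
  by (auto simp: mat_poly_def)

lemma mat_poly_smult:
  assumes T: "T \<in> carrier_mat n n"
  shows "mat_poly (Polynomial.smult c p) T = c \<cdot>\<^sub>m mat_poly p T"
proof (rule eq_matI)
  fix i j assume "i < dim_row (c \<cdot>\<^sub>m mat_poly p T)" "j < dim_col (c \<cdot>\<^sub>m mat_poly p T)"
  then have ij: "i < n" "j < n" using T by (auto simp: mat_poly_def)
  then show "mat_poly (Polynomial.smult c p) T $$ (i, j) = (c \<cdot>\<^sub>m mat_poly p T) $$ (i, j)"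
    using T
    by (simp add: index_mat_poly[OF T ij, of _ "degree p"] degree_smult_le sum_distrib_left mult.assoc)
qed (use T in \<open>auto simp: mat_poly_def\<close>)

text \<open>Together with additivity, this carries a Bezout identity between polynomials over to
  matrices.\<close>

lemma mat_poly_mult:
  assumes T: "T \<in> carrier_mat n n"
  shows "mat_poly (p * q) T = mat_poly p T * mat_poly q T"
proof (induction q)
  case 0
  show ?case using right_mult_zero_mat[OF mat_poly_carrier[OF T, of p], of n] by (simp add: mat_poly_0[OF T])
next
  case (pCons b q)
  note C = mat_poly_carrier[OF T]
  have "0 \<cdot>\<^sub>m 1\<^sub>m n + M = M" if "M \<in> carrier_mat n n" for M :: "rat mat"
    using that by auto
  then have "mat_poly (p * pCons b q) T = b \<cdot>\<^sub>m mat_poly p T + mat_poly p T * mat_poly q T * T"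
    using T
    by (simp add: mult_pCons_right mat_poly_add[OF T] mat_poly_smult[OF T] mat_poly_pCons[OF T] pCons.IH
        mult_carrier_mat[OF mult_carrier_mat[OF C C] T])
  also have "mat_poly p T * mat_poly q T * T = mat_poly p T * (mat_poly q T * T)"
    by (rule assoc_mult_mat[OF C C T])
  also have "b \<cdot>\<^sub>m mat_poly p T + \<dots> = mat_poly p T * (b \<cdot>\<^sub>m 1\<^sub>m n + mat_poly q T * T)"
    using mult_add_distrib_mat[OF C[of p] _ mult_carrier_mat[OF C[of q] T], of "b \<cdot>\<^sub>m 1\<^sub>m n"]
      mult_smult_distrib[OF C[of p] one_carrier_mat, of b] right_mult_one_mat[OF C[of p]] by simp
  finally show ?case by (simp add: mat_poly_pCons[OF T])
qed

lemma mat_poly_dsum: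
  assumes "T \<in> carrier_mat n n" "U \<in> carrier_mat k k"
  shows "mat_poly p (T \<boxplus> U) = mat_poly p T \<boxplus> mat_poly p U"
proof (rule eq_matI)
  fix i j assume "i < dim_row (mat_poly p T \<boxplus> mat_poly p U)" "j < dim_col (mat_poly p T \<boxplus> mat_poly p U)"
  then have ij: "i < n + k" "j < n + k" using assms by (auto simp: mat_poly_def)
  have "T ^\<^sub>m l \<in> carrier_mat n n" "U ^\<^sub>m l \<in> carrier_mat k k" for l
    using assms by auto
  note dims = this[THEN carrier_matD(1)] this[THEN carrier_matD(2)]
  have "(T ^\<^sub>m l \<boxplus> U ^\<^sub>m l) $$ (i, j) = (if i < n then if j < n then (T ^\<^sub>m l) $$ (i, j) else 0
      else if j < n then 0 else (U ^\<^sub>m l) $$ (i - n, j - n))" for l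
    using ij by (simp only: index_dsum dims)
  then show "mat_poly p (T \<boxplus> U) $$ (i, j) = (mat_poly p T \<boxplus> mat_poly p U) $$ (i, j)"
    using ij carrier_matD[OF assms(1)] carrier_matD[OF assms(2)]
    by (auto simp: index_mat_poly[OF dsum_carrier[OF assms] ij order.refl] pow_dsum[OF assms]
        index_dsum index_mat_poly[OF assms(1) _ _ order.refl] index_mat_poly[OF assms(2) _ _ order.refl])
qed (use assms in \<open>auto simp: mat_poly_def\<close>)


subsection \<open>Block sums and S-equivalence\<close>

lemma invertible_matI:
  assumes "A \<in> carrier_mat n n" "B \<in> carrier_mat n n" "A * B = 1\<^sub>m n" "B * A = 1\<^sub>m n"
  shows "invertible_mat A"
  using assms by (auto simp: invertible_mat_def inverts_mat_def)

lemma invertible_matE: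
  assumes "invertible_mat A" "A \<in> carrier_mat n n"
  obtains B where "B \<in> carrier_mat n n" "A * B = 1\<^sub>m n" "B * A = 1\<^sub>m n"
proof -
  obtain B where B: "A * B = 1\<^sub>m n" "B * A = 1\<^sub>m (dim_row B)"
    using assms by (auto simp: invertible_mat_def inverts_mat_def)
  have "dim_col B = n" using arg_cong[OF B(1), of dim_col] by simp
  moreover have "dim_row B = n" using arg_cong[OF B(2), of dim_col] assms(2) by simp
  ultimately show ?thesis using B that by (metis carrier_matI)
qed

text \<open>S is the permutation matrix that exchanges two blocks. As its transpose is its inverse,
  the same conjugation transforms forms and isometries.\<close>

lemma block_swap:
  obtains S :: "'a::field mat" where "S \<in> carrier_mat (a + b) (a + b)"
    "transpose_mat S * S = 1\<^sub>m (a + b)" "S * transpose_mat S = 1\<^sub>m (a + b)"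
    "\<And>A B. A \<in> carrier_mat a a \<Longrightarrow> B \<in> carrier_mat b b \<Longrightarrow>
      transpose_mat S * (A \<boxplus> B) * S = B \<boxplus> A"
proof
  define S :: "'a mat" where "S = four_block_mat (0\<^sub>m a b) (1\<^sub>m a) (1\<^sub>m b) (0\<^sub>m b a)"
  have S': "S \<in> carrier_mat (a + b) (b + a)" by (auto simp: S_def)
  then show S: "S \<in> carrier_mat (a + b) (a + b)" by (simp add: add.commute)
  have St: "transpose_mat S = four_block_mat (0\<^sub>m b a) (1\<^sub>m b) (1\<^sub>m a) (0\<^sub>m a b)"
    unfolding S_def by (subst transpose_four_block_mat[of _ a b _ a _ b]) auto
  have swap: "transpose_mat S * (A \<boxplus> B) * S = B \<boxplus> A"
    if "A \<in> carrier_mat a a" "B \<in> carrier_mat b b" for A B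
  proof -
    have "transpose_mat S * (A \<boxplus> B) = four_block_mat (0\<^sub>m b a) B A (0\<^sub>m a b)"
      unfolding St dsum_def using that
      by (subst mult_four_block_mat[of _ b a _ b _ a _ _ a _ b]) auto
    also have "\<dots> * S = B \<boxplus> A"
      unfolding S_def dsum_def using that
      by (subst mult_four_block_mat[of _ b a _ b _ a _ _ b _ a]) auto
    finally show ?thesis .
  qed
  then show "\<And>A B. A \<in> carrier_mat a a \<Longrightarrow> B \<in> carrier_mat b b \<Longrightarrow>
    transpose_mat S * (A \<boxplus> B) * S = B \<boxplus> A" .
  \<comment> \<open>Exchanging two identity blocks is the orthogonality relation.\<close>
  show 1: "transpose_mat S * S = 1\<^sub>m (a + b)"
    using swap[of "1\<^sub>m a" "1\<^sub>m b"] S right_mult_one_mat[of "transpose_mat S" "a + b" "a + b"]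
    by (simp add: dsum_one add.commute)
  show "S * transpose_mat S = 1\<^sub>m (a + b)"
    by (rule mat_mult_left_right_inverse[OF _ S 1]) (use S in auto)
qed

lemma s_equivalent_refl: "s_equivalent A A"
  by (simp add: s_equivalent_def)

lemma s_equivalent_trans: "s_equivalent A B \<Longrightarrow> s_equivalent B C \<Longrightarrow> s_equivalent A C"
  unfolding s_equivalent_def by (rule equivclp_trans)

lemma dsum_four_block_mat:
  assumes "C \<in> carrier_mat c c" "A \<in> carrier_mat n m" "X \<in> carrier_mat n l"
    "Y \<in> carrier_mat k m" "D \<in> carrier_mat k l"
  shows "C \<boxplus> four_block_mat A X Y D = four_block_mat (C \<boxplus> A)
    (mat (c + n) l (\<lambda>(i, j). if i < c then 0 else X $$ (i - c, j)))
    (mat k (c + m) (\<lambda>(i, j). if j < c then 0 else Y $$ (i, j - c))) D"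
  using assms by (intro eq_matI) (auto simp: index_dsum)

text \<open>A base change is extended by the identity on C, and the vector of an enlargement is
  padded with zeros. C stands in front so that the new corner of size 2 remains the last
  block.\<close>

lemma s_move_dsum:
  assumes "s_move A B" and C: "C \<in> carrier_mat c c"
  shows "s_move (C \<boxplus> A) (C \<boxplus> B)"
  using assms(1)
proof cases
  case (congruence n P)
  from congruence(4,3) obtain Q where Q: "Q \<in> carrier_mat n n" "P * Q = 1\<^sub>m n" "Q * P = 1\<^sub>m n"
    by (rule invertible_matE)
  have "invertible_mat (1\<^sub>m c \<boxplus> P)"
    using congruence(3) Q
    by (intro invertible_matI[of _ "c + n" "1\<^sub>m c \<boxplus> Q"])
      (auto simp: mult_dsum[of _ c c _ c _ n n _ n] dsum_one)
  then have "s_move (C \<boxplus> A) (transpose_mat (1\<^sub>m c \<boxplus> P) * (C \<boxplus> A) * (1\<^sub>m c \<boxplus> P))"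
    using congruence(2,3) C by (intro s_move.congruence[of _ "c + n"]) auto
  also have "transpose_mat (1\<^sub>m c \<boxplus> P) * (C \<boxplus> A) * (1\<^sub>m c \<boxplus> P) = C \<boxplus> B"
    using congruence C
    by (simp add: transpose_dsum mult_dsum[of _ c c _ c _ n n _ n])
  finally show ?thesis .
next
  case (col_enlargement n x)
  let ?X = "mat_of_cols (c + n) [0\<^sub>v c @\<^sub>v x, 0\<^sub>v (c + n)]"
  have X: "mat (c + n) 2 (\<lambda>(i, j). if i < c then 0 else mat_of_cols n [x, 0\<^sub>v n] $$ (i - c, j)) = ?X"
    (is "?Y = _")
  proof (rule eq_matI)
    fix i j assume "i < dim_row ?X" "j < dim_col ?X"
    then have "i < c + n" "j = 0 \<or> j = 1" by auto
    then show "?Y $$ (i, j) = ?X $$ (i, j)"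
      using col_enlargement(3) by (auto simp: mat_of_cols_index)
  qed auto
  have Z: "mat 2 (c + n) (\<lambda>(i, j). if j < c then 0 else 0\<^sub>m 2 n $$ (i, j - c)) = 0\<^sub>m 2 (c + n)"
    by (intro eq_matI) auto
  have "C \<boxplus> B = four_block_mat (C \<boxplus> A) ?X (0\<^sub>m 2 (c + n)) (mat_of_rows_list 2 [[0, 1], [0, 0]])"
    unfolding col_enlargement(1) X[symmetric] Z[symmetric]
    by (rule dsum_four_block_mat[OF C col_enlargement(2)]) (auto simp: mat_of_rows_list_def)
  then show ?thesis
    using s_move.col_enlargement[of "C \<boxplus> A" "c + n" "0\<^sub>v c @\<^sub>v x"] col_enlargement C by simp
next
  case (row_enlargement n x)
  let ?X = "mat_of_rows (c + n) [0\<^sub>v c @\<^sub>v x, 0\<^sub>v (c + n)]"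
  have X: "mat 2 (c + n) (\<lambda>(i, j). if j < c then 0 else mat_of_rows n [x, 0\<^sub>v n] $$ (i, j - c)) = ?X"
    (is "?Y = _")
  proof (rule eq_matI)
    fix i j assume "i < dim_row ?X" "j < dim_col ?X"
    then have "j < c + n" "i = 0 \<or> i = 1" by auto
    then show "?Y $$ (i, j) = ?X $$ (i, j)"
      using row_enlargement(3) by (auto simp: mat_of_rows_index)
  qed auto
  have Z: "mat (c + n) 2 (\<lambda>(i, j). if i < c then 0 else 0\<^sub>m n 2 $$ (i - c, j)) = 0\<^sub>m (c + n) 2"
    by (intro eq_matI) auto
  have "C \<boxplus> B = four_block_mat (C \<boxplus> A) (0\<^sub>m (c + n) 2) ?X (mat_of_rows_list 2 [[0, 0], [1, 0]])"
    unfolding row_enlargement(1) X[symmetric] Z[symmetric]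
    by (rule dsum_four_block_mat[OF C row_enlargement(2)]) (auto simp: mat_of_rows_list_def)
  then show ?thesis
    using s_move.row_enlargement[of "C \<boxplus> A" "c + n" "0\<^sub>v c @\<^sub>v x"] row_enlargement C by simp
qed

lemma s_equivalent_dsum_left:
  assumes "s_equivalent A B" and C: "C \<in> carrier_mat c c"
  shows "s_equivalent (C \<boxplus> A) (C \<boxplus> B)"
  using assms(1) unfolding s_equivalent_def
proof (induction rule: equivclp_induct)
  case base
  then show ?case by simp
next
  case (step X Y)
  then have "equivclp s_move (C \<boxplus> X) (C \<boxplus> Y)"
    using s_move_dsum[OF _ C] by (auto intro: equivclp_sym)
  with step.IH show ?case by (rule equivclp_trans)
qed

lemma s_equivalent_dsum_commute:
  assumes "A \<in> carrier_mat a a" "B \<in> carrier_mat b b"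
  shows "s_equivalent (A \<boxplus> B) (B \<boxplus> A)"
proof -
  obtain S :: "rat mat" where S: "S \<in> carrier_mat (a + b) (a + b)"
    "transpose_mat S * S = 1\<^sub>m (a + b)" "S * transpose_mat S = 1\<^sub>m (a + b)"
    "\<And>A B. A \<in> carrier_mat a a \<Longrightarrow> B \<in> carrier_mat b b \<Longrightarrow>
      transpose_mat S * (A \<boxplus> B) * S = B \<boxplus> A"
    using block_swap by blast
  have "invertible_mat S" using S by (intro invertible_matI[of S "a + b" "transpose_mat S"]) auto
  then have "s_move (A \<boxplus> B) (transpose_mat S * (A \<boxplus> B) * S)"
    using S(1) assms by (intro s_move.congruence[of _ "a + b"]) auto
  then show ?thesis by (auto simp: S(4)[OF assms] s_equivalent_def)
qed

text \<open>Moves act in the second summand only, so the blocks are swapped in between: A + B, A +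
  B', B' + A, B' + A', A' + B', where + is the block sum.\<close>

lemma s_equivalent_dsum:
  assumes "s_equivalent A A'" "s_equivalent B B'" "A \<in> carrier_mat a a" "A' \<in> carrier_mat a' a'"
    "B \<in> carrier_mat b b" "B' \<in> carrier_mat b' b'"
  shows "s_equivalent (A \<boxplus> B) (A' \<boxplus> B')"
  using s_equivalent_dsum_left[OF assms(2,3)] s_equivalent_dsum_commute[OF assms(3,6)]
    s_equivalent_dsum_left[OF assms(1,6)] s_equivalent_dsum_commute[OF assms(6,4)]
  by (blast intro: s_equivalent_trans)


subsection \<open>Block sums of isometric structures\<close>

lemma isometric_structure_dsum:
  assumes "isometric_structure n B T" "isometric_structure k C U"
  shows "isometric_structure (n + k) (B \<boxplus> C) (T \<boxplus> U)"
  using assms unfolding isometric_structure_def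
  by (auto simp: transpose_dsum det_dsum[of _ n _ k] mult_dsum[of _ n n _ n _ k k _ k])

lemma vec_splitE:
  assumes "x \<in> carrier_vec (n + k)"
  obtains v w where "v \<in> carrier_vec n" "w \<in> carrier_vec k" "x = v @\<^sub>v w"
  using vec_first_last_append[OF assms] by (metis vec_first_carrier vec_last_carrier)

lemma append_zero_vec: "0\<^sub>v n @\<^sub>v 0\<^sub>v k = 0\<^sub>v (n + k)"
  by (auto intro!: eq_vecI)

lemma injective_mat_dsum:
  assumes "injective_mat P" "injective_mat Q" "P \<in> carrier_mat n k" "Q \<in> carrier_mat n' k'"
  shows "injective_mat (P \<boxplus> Q)"
  unfolding injective_mat_def
proof (intro ballI impI)
  fix x assume x: "x \<in> carrier_vec (dim_col (P \<boxplus> Q))" and 0: "(P \<boxplus> Q) *\<^sub>v x = 0\<^sub>v (dim_row (P \<boxplus> Q))"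
  have "x \<in> carrier_vec (k + k')" using x assms by auto
  then obtain v w where vw: "v \<in> carrier_vec k" "w \<in> carrier_vec k'" "x = v @\<^sub>v w"
    by (rule vec_splitE)
  have "P *\<^sub>v v @\<^sub>v Q *\<^sub>v w = 0\<^sub>v n @\<^sub>v 0\<^sub>v n'"
    using 0 mult_vec_dsum[OF assms(3,4) vw(1,2)] assms(3,4) by (simp add: vw(3) append_zero_vec)
  then have "P *\<^sub>v v = 0\<^sub>v n" "Q *\<^sub>v w = 0\<^sub>v n'"
    using append_vec_eq[of "P *\<^sub>v v" n "0\<^sub>v n"] assms(3,4) vw by auto
  then have "v = 0\<^sub>v k" "w = 0\<^sub>v k'"
    using assms vw unfolding injective_mat_def by auto
  then show "x = 0\<^sub>v (dim_col (P \<boxplus> Q))"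
    using vw assms(3,4) by (simp add: append_zero_vec)
qed

lemma metabolic_dsum:
  assumes "metabolic B T" "metabolic C U"
    and B: "B \<in> carrier_mat n n" "T \<in> carrier_mat n n" and C: "C \<in> carrier_mat k k" "U \<in> carrier_mat k k"
  shows "metabolic (B \<boxplus> C) (T \<boxplus> U)"
proof -
  obtain m P S where 1: "B \<in> carrier_mat (2 * m) (2 * m)" "P \<in> carrier_mat (2 * m) m" "S \<in> carrier_mat m m"
    "injective_mat P" "transpose_mat P * B * P = 0\<^sub>m m m" "T * P = P * S"
    using assms(1) by (auto simp: metabolic_def)
  obtain l Q R where 2: "C \<in> carrier_mat (2 * l) (2 * l)" "Q \<in> carrier_mat (2 * l) l" "R \<in> carrier_mat l l"
    "injective_mat Q" "transpose_mat Q * C * Q = 0\<^sub>m l l" "U * Q = Q * R"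
    using assms(2) by (auto simp: metabolic_def)
  have n: "n = 2 * m" "k = 2 * l" using 1(1) 2(1) B C by auto
  have T: "T \<in> carrier_mat (2 * m) (2 * m)" "U \<in> carrier_mat (2 * l) (2 * l)" using B C n by auto
  have "B \<boxplus> C \<in> carrier_mat (2 * (m + l)) (2 * (m + l))"
    "P \<boxplus> Q \<in> carrier_mat (2 * (m + l)) (m + l)"
    using 1 2 by (auto simp: distrib_left)
  moreover have "transpose_mat (P \<boxplus> Q) * (B \<boxplus> C) * (P \<boxplus> Q) = 0\<^sub>m (m + l) (m + l)"
    using 1 2 by (simp add: transpose_dsum mult_dsum[of _ m "2 * m" _ "2 * m" _ l "2 * l" _ "2 * l"]
      mult_dsum[of _ m "2 * m" _ m _ l "2 * l" _ l] dsum_zero)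
  moreover have "(T \<boxplus> U) * (P \<boxplus> Q) = (P \<boxplus> Q) * (S \<boxplus> R)"
    using 1 2 T by (simp add: mult_dsum[of _ "2 * m" "2 * m" _ m _ "2 * l" "2 * l" _ l]
      mult_dsum[of _ "2 * m" m _ m _ "2 * l" l _ l])
  ultimately show ?thesis
    unfolding metabolic_def using injective_mat_dsum[OF 1(4) 2(4) 1(2) 2(2)] 1(3) 2(3) by blast
qed

text \<open>In the coordinates given by Q, a metabolizer with basis P has the basis R P, where R
  inverts Q; the matrix S of the restricted isometry stays the same.\<close>

lemma metabolic_congruence:
  assumes "metabolic B T" "T \<in> carrier_mat n n" "Q \<in> carrier_mat n n" "R \<in> carrier_mat n n"
    "Q * R = 1\<^sub>m n" and B: "B \<in> carrier_mat n n"
  shows "metabolic (transpose_mat Q * B * Q) (R * T * Q)"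
proof -
  obtain m P S where 1: "B \<in> carrier_mat (2 * m) (2 * m)" "P \<in> carrier_mat (2 * m) m" "S \<in> carrier_mat m m"
    "injective_mat P" "transpose_mat P * B * P = 0\<^sub>m m m" "T * P = P * S"
    using assms(1) by (auto simp: metabolic_def)
  have n: "n = 2 * m" using 1(1) B by auto
  note c = assms(2-6)[unfolded n]
  have QRM: "Q * (R * M) = M" if "M \<in> carrier_mat (2 * m) l" for M l
    using that c by (simp add: assoc_mult_mat[of Q "2 * m" "2 * m" R "2 * m" M l, symmetric])
  have inj: "injective_mat (R * P)"
    unfolding injective_mat_def
  proof (intro ballI impI)
    fix x assume x: "x \<in> carrier_vec (dim_col (R * P))" "(R * P) *\<^sub>v x = 0\<^sub>v (dim_row (R * P))"
    then have x': "x \<in> carrier_vec m" using 1 by simp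
    have "P *\<^sub>v x = (Q * (R * P)) *\<^sub>v x" using QRM[OF 1(2)] by simp
    also have "\<dots> = Q *\<^sub>v ((R * P) *\<^sub>v x)"
      using c 1 x' by (intro assoc_mult_mat_vec) auto
    also have "\<dots> = 0\<^sub>v (2 * m)" using x(2) c by auto
    finally show "x = 0\<^sub>v (dim_col (R * P))"
      using 1(2,4) x' unfolding injective_mat_def by auto
  qed
  have "transpose_mat (R * P) * (transpose_mat Q * B * Q) * (R * P)
      = transpose_mat (Q * (R * P)) * B * (Q * (R * P))"
  proof -
    have RP: "R * P \<in> carrier_mat (2 * m) m" using c 1 by auto
    have "transpose_mat (Q * (R * P)) = transpose_mat (R * P) * transpose_mat Q"
      using c RP by (intro transpose_mult) auto
    then show ?thesis using c RP
      by (simp add: assoc_mult_mat[of _ m "2 * m" _ "2 * m" _ "2 * m"] assoc_mult_mat[of _ m "2 * m" _ "2 * m" _ m]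
        assoc_mult_mat[of _ "2 * m" "2 * m" _ "2 * m" _ m] assoc_mult_mat[of _ "2 * m" "2 * m" _ "2 * m" _ "2 * m"])
  qed
  then have "transpose_mat (R * P) * (transpose_mat Q * B * Q) * (R * P) = 0\<^sub>m m m"
    by (simp add: QRM[OF 1(2)] 1(5))
  moreover have "R * T * Q * (R * P) = R * P * S"
  proof -
    have "R * T * Q * (R * P) = R * T * (Q * (R * P))"
      using c 1 by (intro assoc_mult_mat[of _ "2 * m" "2 * m" _ "2 * m" _ m]) auto
    also have "\<dots> = R * (T * P)"
      unfolding QRM[OF 1(2)] using c 1 by (intro assoc_mult_mat) auto
    also have "\<dots> = R * P * S"
      unfolding 1(6) using c 1 by (intro assoc_mult_mat[symmetric]) auto
    finally show ?thesis .
  qed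
  ultimately show ?thesis unfolding metabolic_def using inj 1 c
    by (intro exI[of _ m] exI[of _ "R * P"] exI[of _ S]) auto
qed

section \<open>Witt equivalence and block sums\<close>

lemma witt_equivalent_iff: "witt_equivalent B T C U \<longleftrightarrow> metabolic (B \<boxplus> - C) (T \<boxplus> U)"
  by (simp only: witt_equivalent_def diag_block_mat_Cons_dsum diag_block_mat.simps(1) dsum_empty)

text \<open>The sum of the two metabolic structures has its blocks in the order B, -B', C, -C',
  whereas the claim asks for B, C, -B', -C'. The orthogonal matrix Q exchanges the two middle
  blocks.\<close>

lemma witt_equivalent_dsum:
  assumes "witt_equivalent B T B' T'" "witt_equivalent C U C' U'"
    and B: "B \<in> carrier_mat a a" "T \<in> carrier_mat a a" and B': "B' \<in> carrier_mat b b" "T' \<in> carrier_mat b b"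
    and C: "C \<in> carrier_mat c c" "U \<in> carrier_mat c c" and C': "C' \<in> carrier_mat d d" "U' \<in> carrier_mat d d"
  shows "witt_equivalent (B \<boxplus> C) (T \<boxplus> U) (B' \<boxplus> C') (T' \<boxplus> U')"
proof -
  obtain S :: "rat mat" where S: "S \<in> carrier_mat (b + c) (b + c)"
    "transpose_mat S * S = 1\<^sub>m (b + c)" "S * transpose_mat S = 1\<^sub>m (b + c)"
    "\<And>A B. A \<in> carrier_mat b b \<Longrightarrow> B \<in> carrier_mat c c \<Longrightarrow>
      transpose_mat S * (A \<boxplus> B) * S = B \<boxplus> A"
    using block_swap by blast
  define Q where "Q = 1\<^sub>m a \<boxplus> (S \<boxplus> 1\<^sub>m d)"
  have Q: "Q \<in> carrier_mat (a + (b + c + d)) (a + (b + c + d))" using S by (auto simp: Q_def)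
  have conj: "transpose_mat Q * ((X \<boxplus> Y) \<boxplus> (Z \<boxplus> W)) * Q = (X \<boxplus> Z) \<boxplus> (Y \<boxplus> W)"
    if c: "X \<in> carrier_mat a a" "Y \<in> carrier_mat b b" "Z \<in> carrier_mat c c" "W \<in> carrier_mat d d"
    for X Y Z W
  proof -
    have YZ: "Y \<boxplus> Z \<in> carrier_mat (b + c) (b + c)" using c by auto
    have "(X \<boxplus> Y) \<boxplus> (Z \<boxplus> W) = X \<boxplus> ((Y \<boxplus> Z) \<boxplus> W)" by (simp add: dsum_assoc)
    moreover have "transpose_mat Q = 1\<^sub>m a \<boxplus> (transpose_mat S \<boxplus> 1\<^sub>m d)"
      by (simp add: Q_def transpose_dsum)
    ultimately have "transpose_mat Q * ((X \<boxplus> Y) \<boxplus> (Z \<boxplus> W)) * Q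
        = X \<boxplus> ((transpose_mat S * (Y \<boxplus> Z) * S) \<boxplus> W)"
      unfolding Q_def using c S(1) YZ
      by (simp add: mult_dsum[of _ a a _ a _ "b + c + d" "b + c + d" _ "b + c + d"]
        mult_dsum[of _ "b + c" "b + c" _ "b + c" _ d d _ d])
    also have "\<dots> = (X \<boxplus> Z) \<boxplus> (Y \<boxplus> W)" by (simp add: S(4)[OF c(2,3)] dsum_assoc)
    finally show ?thesis .
  qed
  have "metabolic ((B \<boxplus> - B') \<boxplus> (C \<boxplus> - C')) ((T \<boxplus> T') \<boxplus> (U \<boxplus> U'))"
    by (rule metabolic_dsum[OF assms(1,2)[unfolded witt_equivalent_iff], of "a + b" "c + d"])
      (use assms(3-10) in auto)
  then have "metabolic (transpose_mat Q * ((B \<boxplus> - B') \<boxplus> (C \<boxplus> - C')) * Q)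
      (transpose_mat Q * ((T \<boxplus> T') \<boxplus> (U \<boxplus> U')) * Q)"
  proof (rule metabolic_congruence)
    have "Q * transpose_mat Q = 1\<^sub>m a \<boxplus> ((S * transpose_mat S) \<boxplus> 1\<^sub>m d)"
      unfolding Q_def using S(1)
      by (simp add: transpose_dsum mult_dsum[of _ a a _ a _ "b + c + d" "b + c + d" _ "b + c + d"]
        mult_dsum[of _ "b + c" "b + c" _ "b + c" _ d d _ d])
    then show "Q * transpose_mat Q = 1\<^sub>m (a + (b + c + d))" by (simp add: S(3) dsum_one)
    show "(T \<boxplus> T') \<boxplus> (U \<boxplus> U') \<in> carrier_mat (a + (b + c + d)) (a + (b + c + d))"
      "(B \<boxplus> - B') \<boxplus> (C \<boxplus> - C') \<in> carrier_mat (a + (b + c + d)) (a + (b + c + d))"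
      using assms(3-10) by (auto intro!: carrier_matI)
  qed (use Q in auto)
  then show ?thesis
    using assms(3-10) by (simp add: conj witt_equivalent_iff uminus_dsum)
qed

text \<open>The graph of the identity is a metabolizer.\<close>

lemma witt_equivalent_refl:
  assumes "B \<in> carrier_mat n n" "T \<in> carrier_mat n n"
  shows "witt_equivalent B T B T"
  unfolding witt_equivalent_iff metabolic_def
proof (intro exI conjI)
  \<comment> \<open>Column i is the pair (e_i, e_i). The blocks of width 0 bring P into the
    four-block shape that the multiplication rule expects.\<close>
  define P :: "rat mat" where "P = four_block_mat (1\<^sub>m n) (0\<^sub>m n 0) (1\<^sub>m n) (0\<^sub>m n 0)"
  show "B \<boxplus> - B \<in> carrier_mat (2 * n) (2 * n)" using assms by (simp add: mult_2)
  show P: "P \<in> carrier_mat (2 * n) n" by (rule carrier_matI) (auto simp: P_def)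
  show "T \<in> carrier_mat n n" by fact
  have Pt: "transpose_mat P = four_block_mat (1\<^sub>m n) (1\<^sub>m n) (0\<^sub>m 0 n) (0\<^sub>m 0 n)"
    unfolding P_def by (subst transpose_four_block_mat[of _ n n _ 0 _ n]) auto
  have "transpose_mat P * (B \<boxplus> - B) = four_block_mat B (- B) (0\<^sub>m 0 n) (0\<^sub>m 0 n)"
    unfolding Pt dsum_def using assms
    by (subst mult_four_block_mat[of _ n n _ n _ 0 _ _ n _ n]) auto
  then show "transpose_mat P * (B \<boxplus> - B) * P = 0\<^sub>m n n"
    unfolding P_def using assms
    by (simp, subst mult_four_block_mat[of _ n n _ n _ 0 _ _ n _ 0]) (auto intro!: eq_matI)
  have TP: "(T \<boxplus> T) * P = four_block_mat T (0\<^sub>m n 0) T (0\<^sub>m n 0)"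
    unfolding P_def dsum_def using assms
    by (subst mult_four_block_mat[of _ n n _ n _ n _ _ n _ 0]) auto
  have "four_block_mat T (0\<^sub>m n 0) (0\<^sub>m 0 n) (0\<^sub>m 0 0) = T"
    using assms by (auto intro!: eq_matI)
  then have "P * T = P * four_block_mat T (0\<^sub>m n 0) (0\<^sub>m 0 n) (0\<^sub>m 0 0)" by simp
  also have "\<dots> = four_block_mat T (0\<^sub>m n 0) T (0\<^sub>m n 0)"
    unfolding P_def using assms
    by (subst mult_four_block_mat[of _ n n _ 0 _ n _ _ n _ 0]) auto
  finally show "(T \<boxplus> T) * P = P * T" using TP by simp
  show "injective_mat P"
    unfolding injective_mat_def
  proof (intro ballI impI)
    fix x assume x: "x \<in> carrier_vec (dim_col P)" "P *\<^sub>v x = 0\<^sub>v (dim_row P)"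
    have x': "x \<in> carrier_vec n" using x P by auto
    have "x $ i = 0" if "i < n" for i
    proof -
      have "x $ i = (P *\<^sub>v x) $ i"
        using that x' by (auto simp: P_def scalar_prod_def if_distrib[of "\<lambda>t. t * _"] cong: if_cong)
      then show ?thesis using that x P by auto
    qed
    then show "x = 0\<^sub>v (dim_col P)" using x' P by (auto intro!: eq_vecI)
  qed
qed

section \<open>Primary parts of block sums\<close>

lemma pow_mat_mult_vec_eq_0:
  fixes M :: "'a::comm_ring_1 mat"
  assumes M: "M \<in> carrier_mat n n" and v: "v \<in> carrier_vec n"
    and 0: "(M ^\<^sub>m e) *\<^sub>v v = 0\<^sub>v n" and "e \<le> e'"
  shows "(M ^\<^sub>m e') *\<^sub>v v = 0\<^sub>v n"
  using \<open>e \<le> e'\<close>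
proof (induction e' rule: dec_induct)
  case base
  then show ?case using 0 by simp
next
  case (step k)
  have "M ^\<^sub>m k * M = M * M ^\<^sub>m k"
  proof (induction k)
    case (Suc k)
    have "M ^\<^sub>m Suc k * M = M * M ^\<^sub>m k * M" using Suc by simp
    also have "\<dots> = M * M ^\<^sub>m Suc k" using M by (simp add: assoc_mult_mat[of M n n _ n M n])
    finally show ?case .
  qed (use M in auto)
  then have "(M ^\<^sub>m Suc k) *\<^sub>v v = M *\<^sub>v ((M ^\<^sub>m k) *\<^sub>v v)"
    using M v by (simp add: assoc_mult_mat_vec[of M n n _ n])
  then show ?case using step.IH M by auto
qed

lemma primary_part_carrier:
  assumes "primary_part p B T B\<^sub>0 T\<^sub>0"
  obtains k where "B\<^sub>0 \<in> carrier_mat k k" "T\<^sub>0 \<in> carrier_mat k k"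
proof -
  obtain n k P where P: "B \<in> carrier_mat n n" "P \<in> carrier_mat n k" "T\<^sub>0 \<in> carrier_mat k k"
    "B\<^sub>0 = transpose_mat P * B * P"
    using assms unfolding primary_part_def by blast
  then have "B\<^sub>0 \<in> carrier_mat k k" by (auto intro!: mult_carrier_mat[of _ k n])
  then show ?thesis using P(3) by (rule that)
qed

text \<open>A vector of the sum is killed by some power of p of the isometry exactly if both
  components are: each component comes with its own exponent, and the maximum serves for
  both.\<close>

lemma primary_part_dsum:
  assumes "primary_part p B T B\<^sub>0 T\<^sub>0" "primary_part p C U C\<^sub>0 U\<^sub>0"
  shows "primary_part p (B \<boxplus> C) (T \<boxplus> U) (B\<^sub>0 \<boxplus> C\<^sub>0) (T\<^sub>0 \<boxplus> U\<^sub>0)"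
proof -
  obtain n k P where 1: "B \<in> carrier_mat n n" "T \<in> carrier_mat n n" "P \<in> carrier_mat n k"
    "T\<^sub>0 \<in> carrier_mat k k" "injective_mat P" "T * P = P * T\<^sub>0" "B\<^sub>0 = transpose_mat P * B * P"
    and img1: "{P *\<^sub>v x | x. x \<in> carrier_vec k} =
      {v \<in> carrier_vec n. \<exists>e. (mat_poly p T ^\<^sub>m e) *\<^sub>v v = 0\<^sub>v n}"
    using assms(1) unfolding primary_part_def by blast
  obtain n' k' Q where 2: "C \<in> carrier_mat n' n'" "U \<in> carrier_mat n' n'" "Q \<in> carrier_mat n' k'"
    "U\<^sub>0 \<in> carrier_mat k' k'" "injective_mat Q" "U * Q = Q * U\<^sub>0" "C\<^sub>0 = transpose_mat Q * C * Q"
    and img2: "{Q *\<^sub>v x | x. x \<in> carrier_vec k'} =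
      {v \<in> carrier_vec n'. \<exists>e. (mat_poly p U ^\<^sub>m e) *\<^sub>v v = 0\<^sub>v n'}"
    using assms(2) unfolding primary_part_def by blast
  let ?M = "mat_poly p T" and ?N = "mat_poly p U"
  have M: "?M \<in> carrier_mat n n" "?N \<in> carrier_mat n' n'" using 1 2 by auto
  have act: "(mat_poly p (T \<boxplus> U) ^\<^sub>m e) *\<^sub>v (v @\<^sub>v w) = (?M ^\<^sub>m e) *\<^sub>v v @\<^sub>v (?N ^\<^sub>m e) *\<^sub>v w"
    if "v \<in> carrier_vec n" "w \<in> carrier_vec n'" for e v w
    unfolding mat_poly_dsum[OF 1(2) 2(2)] pow_dsum[OF M]
    using M that by (intro mult_vec_dsum[of _ n n _ n' n']) auto
  have kernel: "(\<exists>e. (mat_poly p (T \<boxplus> U) ^\<^sub>m e) *\<^sub>v (v @\<^sub>v w) = 0\<^sub>v (n + n')) \<longleftrightarrow>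
      (\<exists>e. (?M ^\<^sub>m e) *\<^sub>v v = 0\<^sub>v n) \<and> (\<exists>e. (?N ^\<^sub>m e) *\<^sub>v w = 0\<^sub>v n')"
    if vw: "v \<in> carrier_vec n" "w \<in> carrier_vec n'" for v w
  proof -
    have split: "(mat_poly p (T \<boxplus> U) ^\<^sub>m e) *\<^sub>v (v @\<^sub>v w) = 0\<^sub>v (n + n') \<longleftrightarrow>
        (?M ^\<^sub>m e) *\<^sub>v v = 0\<^sub>v n \<and> (?N ^\<^sub>m e) *\<^sub>v w = 0\<^sub>v n'" for e
      unfolding act[OF vw] append_zero_vec[symmetric]
      by (rule append_vec_eq[of _ n]) (use M vw in \<open>auto intro: mult_mat_vec_carrier pow_carrier_mat\<close>)
    show ?thesis
      unfolding split
      using pow_mat_mult_vec_eq_0[OF M(1) vw(1)] pow_mat_mult_vec_eq_0[OF M(2) vw(2)]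
      by (meson max.cobounded1 max.cobounded2)
  qed
  have "{(P \<boxplus> Q) *\<^sub>v x | x. x \<in> carrier_vec (k + k')} =
      {v \<in> carrier_vec (n + n'). \<exists>e. (mat_poly p (T \<boxplus> U) ^\<^sub>m e) *\<^sub>v v = 0\<^sub>v (n + n')}" (is "?L = ?R")
  proof (intro equalityI subsetI)
    fix y assume "y \<in> ?L"
    then obtain x where x: "x \<in> carrier_vec (k + k')" "y = (P \<boxplus> Q) *\<^sub>v x" by blast
    obtain v w where vw: "v \<in> carrier_vec k" "w \<in> carrier_vec k'" "x = v @\<^sub>v w"
      using x(1) by (rule vec_splitE)
    have y: "y = P *\<^sub>v v @\<^sub>v Q *\<^sub>v w"
      unfolding x(2) vw(3) by (rule mult_vec_dsum[OF 1(3) 2(3) vw(1,2)])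
    have "P *\<^sub>v v \<in> {v \<in> carrier_vec n. \<exists>e. (?M ^\<^sub>m e) *\<^sub>v v = 0\<^sub>v n}"
      "Q *\<^sub>v w \<in> {v \<in> carrier_vec n'. \<exists>e. (?N ^\<^sub>m e) *\<^sub>v v = 0\<^sub>v n'}"
      using img1 img2 vw by blast+
    then show "y \<in> ?R" unfolding y by (auto simp: kernel)
  next
    fix y assume y: "y \<in> ?R"
    then obtain v w where vw: "v \<in> carrier_vec n" "w \<in> carrier_vec n'" "y = v @\<^sub>v w"
      by (auto elim: vec_splitE)
    have "v \<in> {v \<in> carrier_vec n. \<exists>e. (?M ^\<^sub>m e) *\<^sub>v v = 0\<^sub>v n}"
      "w \<in> {v \<in> carrier_vec n'. \<exists>e. (?N ^\<^sub>m e) *\<^sub>v v = 0\<^sub>v n'}"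
      using y vw by (auto simp: kernel)
    then obtain a b where "a \<in> carrier_vec k" "v = P *\<^sub>v a" "b \<in> carrier_vec k'" "w = Q *\<^sub>v b"
      unfolding img1[symmetric] img2[symmetric] by blast
    then show "y \<in> ?L"
      using mult_vec_dsum[OF 1(3) 2(3)] vw(3) by (auto intro!: exI[of _ "a @\<^sub>v b"])
  qed
  moreover have "(T \<boxplus> U) * (P \<boxplus> Q) = (P \<boxplus> Q) * (T\<^sub>0 \<boxplus> U\<^sub>0)"
    using 1 2 by (simp add: mult_dsum[of _ n n _ k _ n' n' _ k'] mult_dsum[of _ n k _ k _ n' k' _ k'])
  moreover have "B\<^sub>0 \<boxplus> C\<^sub>0 = transpose_mat (P \<boxplus> Q) * (B \<boxplus> C) * (P \<boxplus> Q)"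
    using 1 2 by (simp add: transpose_dsum mult_dsum[of _ k n _ n _ k' n' _ n']
        mult_dsum[of _ k n _ k _ k' n' _ k'])
  ultimately show ?thesis
    unfolding primary_part_def
    using dsum_carrier[OF 1(1) 2(1)] dsum_carrier[OF 1(2) 2(2)] dsum_carrier[OF 1(3) 2(3)]
      dsum_carrier[OF 1(4) 2(4)] injective_mat_dsum[OF 1(5) 2(5) 1(3) 2(3)]
    by blast
qed

section \<open>Hermitian lifts of block sums\<close>

lemma map_vec_append: "map_vec f (v @\<^sub>v w) = map_vec f v @\<^sub>v map_vec f w"
  by (auto intro!: eq_vecI)

text \<open>The two identifications act side by side. Beyond bookkeeping, the point is that the
  rational form on the sum is a sum of two traces, which has to be the trace of the sum of the
  Hermitian values.\<close>

lemma hermitian_lift_dsum: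
  assumes z: "reciprocal z"
    and "hermitian_lift z n B T r h" "hermitian_lift z k C U s g"
    and B: "B \<in> carrier_mat n n" "T \<in> carrier_mat n n" and C: "C \<in> carrier_mat k k" "U \<in> carrier_mat k k"
  shows "hermitian_lift z (n + k) (B \<boxplus> C) (T \<boxplus> U) (r + s) (h \<boxplus> g)"
proof -
  define K where "K r = {x \<in> carrier_vec r. \<forall>i<r. x $ i \<in> number_field z}" for r
  let ?\<sigma> = "map_vec (involution z)"
  obtain \<phi> where h: "h \<in> carrier_mat r r" "det h \<noteq> 0"
    "\<forall>i<r. \<forall>j<r. h $$ (i, j) \<in> number_field z \<and> h $$ (i, j) = involution z (h $$ (j, i))"
    and \<phi>: "bij_betw \<phi> (carrier_vec n) (K r)"
    "\<forall>v \<in> carrier_vec n. \<forall>w \<in> carrier_vec n. \<phi> (v + w) = \<phi> v + \<phi> w"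
    "\<forall>v \<in> carrier_vec n. \<phi> (T *\<^sub>v v) = z \<cdot>\<^sub>v \<phi> v"
    "\<forall>v \<in> carrier_vec n. \<forall>w \<in> carrier_vec n. v \<bullet> (B *\<^sub>v w) = field_trace z (\<phi> v \<bullet> (h *\<^sub>v ?\<sigma> (\<phi> w)))"
    using assms(2) unfolding hermitian_lift_def K_def by blast
  obtain \<psi> where g: "g \<in> carrier_mat s s" "det g \<noteq> 0"
    "\<forall>i<s. \<forall>j<s. g $$ (i, j) \<in> number_field z \<and> g $$ (i, j) = involution z (g $$ (j, i))"
    and \<psi>: "bij_betw \<psi> (carrier_vec k) (K s)"
    "\<forall>v \<in> carrier_vec k. \<forall>w \<in> carrier_vec k. \<psi> (v + w) = \<psi> v + \<psi> w"
    "\<forall>v \<in> carrier_vec k. \<psi> (U *\<^sub>v v) = z \<cdot>\<^sub>v \<psi> v"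
    "\<forall>v \<in> carrier_vec k. \<forall>w \<in> carrier_vec k. v \<bullet> (C *\<^sub>v w) = field_trace z (\<psi> v \<bullet> (g *\<^sub>v ?\<sigma> (\<psi> w)))"
    using assms(3) unfolding hermitian_lift_def K_def by blast
  define \<chi> where "\<chi> x = \<phi> (vec_first x n) @\<^sub>v \<psi> (vec_last x k)" for x
  have \<chi>: "\<chi> (v @\<^sub>v w) = \<phi> v @\<^sub>v \<psi> w" if "v \<in> carrier_vec n" "w \<in> carrier_vec k" for v w
  proof -
    have "vec_first (v @\<^sub>v w) n = v" "vec_last (v @\<^sub>v w) k = w"
      using that by (auto simp: vec_first_def vec_last_def intro!: eq_vecI)
    then show ?thesis by (simp add: \<chi>_def)
  qed
  have \<phi>K: "\<phi> v \<in> K r" if "v \<in> carrier_vec n" for v using \<phi>(1) that by (auto simp: bij_betw_def)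
  have \<psi>K: "\<psi> v \<in> K s" if "v \<in> carrier_vec k" for v using \<psi>(1) that by (auto simp: bij_betw_def)
  have \<phi>c: "\<phi> v \<in> carrier_vec r" if "v \<in> carrier_vec n" for v using \<phi>K[OF that] by (simp add: K_def)
  have \<psi>c: "\<psi> v \<in> carrier_vec s" if "v \<in> carrier_vec k" for v using \<psi>K[OF that] by (simp add: K_def)
  have K_append: "x @\<^sub>v y \<in> K (r + s) \<longleftrightarrow> x \<in> K r \<and> y \<in> K s"
    if "x \<in> carrier_vec r" "y \<in> carrier_vec s" for x y
  proof
    assume xy: "x @\<^sub>v y \<in> K (r + s)"
    have "x $ i \<in> number_field z" if "i < r" for i
    proof -
      have "(x @\<^sub>v y) $ i \<in> number_field z" using xy that by (simp add: K_def)
      then show ?thesis using that \<open>x \<in> carrier_vec r\<close> \<open>y \<in> carrier_vec s\<close> by simp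
    qed
    moreover have "y $ i \<in> number_field z" if "i < s" for i
    proof -
      have "(x @\<^sub>v y) $ (r + i) \<in> number_field z" using xy that by (simp add: K_def)
      then show ?thesis using that \<open>x \<in> carrier_vec r\<close> \<open>y \<in> carrier_vec s\<close> by simp
    qed
    ultimately show "x \<in> K r \<and> y \<in> K s" using that by (simp add: K_def)
  qed (use that in \<open>auto simp: K_def\<close>)
  have bij: "bij_betw \<chi> (carrier_vec (n + k)) (K (r + s))"
  proof (rule bij_betwI')
    fix x y :: "rat vec" assume "x \<in> carrier_vec (n + k)" "y \<in> carrier_vec (n + k)"
    then obtain v w v' w' where vw: "v \<in> carrier_vec n" "w \<in> carrier_vec k" "x = v @\<^sub>v w"
      "v' \<in> carrier_vec n" "w' \<in> carrier_vec k" "y = v' @\<^sub>v w'"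
      by (metis vec_splitE)
    have "\<chi> x = \<chi> y \<longleftrightarrow> \<phi> v = \<phi> v' \<and> \<psi> w = \<psi> w'"
      using vw \<phi>c by (simp add: \<chi> append_vec_eq[of _ r])
    also have "\<dots> \<longleftrightarrow> v = v' \<and> w = w'"
      using vw bij_betw_imp_inj_on[OF \<phi>(1)] bij_betw_imp_inj_on[OF \<psi>(1)] by (metis inj_onD)
    also have "\<dots> \<longleftrightarrow> x = y" using vw by (simp add: append_vec_eq[of _ n])
    finally show "\<chi> x = \<chi> y \<longleftrightarrow> x = y" .
  next
    fix x :: "rat vec" assume "x \<in> carrier_vec (n + k)"
    then show "\<chi> x \<in> K (r + s)"
      by (rule vec_splitE) (auto simp: \<chi> K_append \<phi>c \<psi>c \<phi>K \<psi>K)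
  next
    fix x assume x: "x \<in> K (r + s)"
    then have "x \<in> carrier_vec (r + s)" by (simp add: K_def)
    then obtain a b where ab: "a \<in> carrier_vec r" "b \<in> carrier_vec s" "x = a @\<^sub>v b" by (rule vec_splitE)
    then have "a \<in> K r" "b \<in> K s" using x K_append by auto
    then obtain v w where "v \<in> carrier_vec n" "a = \<phi> v" "w \<in> carrier_vec k" "b = \<psi> w"
      using bij_betw_imp_surj_on[OF \<phi>(1)] bij_betw_imp_surj_on[OF \<psi>(1)] by blast
    then show "\<exists>y\<in>carrier_vec (n + k). x = \<chi> y"
      using ab(3) \<chi> by (intro bexI[of _ "v @\<^sub>v w"]) auto
  qed
  have add: "\<chi> (x + y) = \<chi> x + \<chi> y" if xy: "x \<in> carrier_vec (n + k)" "y \<in> carrier_vec (n + k)" for x y :: "rat vec"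
  proof -
    obtain v w where vw: "v \<in> carrier_vec n" "w \<in> carrier_vec k" "x = v @\<^sub>v w"
      using xy(1) by (rule vec_splitE)
    obtain v' w' where vw': "v' \<in> carrier_vec n" "w' \<in> carrier_vec k" "y = v' @\<^sub>v w'"
      using xy(2) by (rule vec_splitE)
    have "x + y = (v + v') @\<^sub>v (w + w')"
      unfolding vw(3) vw'(3) by (rule append_vec_add[OF vw(1) vw'(1) vw(2) vw'(2)])
    then show ?thesis
      using vw vw' \<phi>(2) \<psi>(2) append_vec_add[OF \<phi>c[OF vw(1)] \<phi>c[OF vw'(1)] \<psi>c[OF vw(2)] \<psi>c[OF vw'(2)]]
      by (simp add: \<chi>)
  qed
  have act: "\<chi> ((T \<boxplus> U) *\<^sub>v x) = z \<cdot>\<^sub>v \<chi> x" if x: "x \<in> carrier_vec (n + k)" for x :: "rat vec"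
  proof -
    obtain v w where vw: "v \<in> carrier_vec n" "w \<in> carrier_vec k" "x = v @\<^sub>v w"
      using x by (rule vec_splitE)
    have "\<chi> ((T \<boxplus> U) *\<^sub>v x) = \<phi> (T *\<^sub>v v) @\<^sub>v \<psi> (U *\<^sub>v w)"
      unfolding vw(3) mult_vec_dsum[OF B(2) C(2) vw(1,2)] using B C vw by (intro \<chi>) auto
    also have "\<dots> = z \<cdot>\<^sub>v \<chi> x"
      using vw \<phi>(3) \<psi>(3) by (auto simp: \<chi> intro!: eq_vecI)
    finally show ?thesis .
  qed
  \<comment> \<open>\<open>field_trace\<close> is additive on the field, being a definite
    description with no known value elsewhere, so the Hermitian values must be located
    there.\<close>
  have in_field: "x \<bullet> (M *\<^sub>v ?\<sigma> y) \<in> number_field z"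
    if "x \<in> K l" "y \<in> K l" "M \<in> carrier_mat l l" "\<forall>i<l. \<forall>j<l. M $$ (i, j) \<in> number_field z" for x y l M
    using that unfolding scalar_prod_def K_def
    by (auto simp: scalar_prod_def intro!: number_field_sum[OF z] number_field_mult[OF z]
        involution_in_number_field[OF z])
  have trace: "x \<bullet> ((B \<boxplus> C) *\<^sub>v y) = field_trace z (\<chi> x \<bullet> ((h \<boxplus> g) *\<^sub>v ?\<sigma> (\<chi> y)))"
    if xy: "x \<in> carrier_vec (n + k)" "y \<in> carrier_vec (n + k)" for x y :: "rat vec"
  proof -
    obtain v w where vw: "v \<in> carrier_vec n" "w \<in> carrier_vec k" "x = v @\<^sub>v w"
      using xy(1) by (rule vec_splitE)
    obtain v' w' where vw': "v' \<in> carrier_vec n" "w' \<in> carrier_vec k" "y = v' @\<^sub>v w'"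
      using xy(2) by (rule vec_splitE)
    have "x \<bullet> ((B \<boxplus> C) *\<^sub>v y) = v \<bullet> (B *\<^sub>v v') + w \<bullet> (C *\<^sub>v w')"
      unfolding vw(3) vw'(3) mult_vec_dsum[OF B(1) C(1) vw'(1,2)]
      by (rule scalar_prod_append) (use vw vw' B C in auto)
    also have "\<dots> = field_trace z (\<phi> v \<bullet> (h *\<^sub>v ?\<sigma> (\<phi> v'))) + field_trace z (\<psi> w \<bullet> (g *\<^sub>v ?\<sigma> (\<psi> w')))"
      using vw vw' \<phi>(4) \<psi>(4) by simp
    also have "\<dots> = field_trace z (\<phi> v \<bullet> (h *\<^sub>v ?\<sigma> (\<phi> v')) + \<psi> w \<bullet> (g *\<^sub>v ?\<sigma> (\<psi> w')))"
      by (rule field_trace_add[OF z in_field[OF \<phi>K[OF vw(1)] \<phi>K[OF vw'(1)] h(1)]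
          in_field[OF \<psi>K[OF vw(2)] \<psi>K[OF vw'(2)] g(1)], symmetric]) (use h(3) g(3) in blast)+
    also have "\<phi> v \<bullet> (h *\<^sub>v ?\<sigma> (\<phi> v')) + \<psi> w \<bullet> (g *\<^sub>v ?\<sigma> (\<psi> w'))
        = (\<phi> v @\<^sub>v \<psi> w) \<bullet> (h *\<^sub>v ?\<sigma> (\<phi> v') @\<^sub>v g *\<^sub>v ?\<sigma> (\<psi> w'))"
      by (rule scalar_prod_append[symmetric]) (use vw vw' \<phi>c \<psi>c h g in \<open>auto intro!: mult_mat_vec_carrier\<close>)
    also have "h *\<^sub>v ?\<sigma> (\<phi> v') @\<^sub>v g *\<^sub>v ?\<sigma> (\<psi> w') = (h \<boxplus> g) *\<^sub>v ?\<sigma> (\<chi> y)"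
      unfolding vw'(3) \<chi>[OF vw'(1,2)] map_vec_append
      by (rule mult_vec_dsum[OF h(1) g(1), symmetric]) (use vw' \<phi>c \<psi>c in auto)
    finally show ?thesis using vw by (simp add: \<chi>)
  qed
  have "\<forall>i<r + s. \<forall>j<r + s. (h \<boxplus> g) $$ (i, j) \<in> number_field z \<and>
      (h \<boxplus> g) $$ (i, j) = involution z ((h \<boxplus> g) $$ (j, i))"
  proof (intro allI impI)
    fix i j assume ij: "i < r + s" "j < r + s"
    have h': "h $$ (i, j) \<in> number_field z \<and> h $$ (i, j) = involution z (h $$ (j, i))" if "i < r" "j < r"
      using h(3) that by blast
    have g': "g $$ (i - r, j - r) \<in> number_field z \<and> g $$ (i - r, j - r) = involution z (g $$ (j - r, i - r))"
      if "\<not> i < r" "\<not> j < r"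
    proof -
      have "i - r < s" "j - r < s" using ij that by auto
      then show ?thesis using g(3) by blast
    qed
    note index = index_dsum[of _ h g, unfolded h(1)[THEN carrier_matD(1)] h(1)[THEN carrier_matD(2)]
        g(1)[THEN carrier_matD(1)] g(1)[THEN carrier_matD(2)]]
    consider "i < r" "j < r" | "\<not> i < r" "\<not> j < r" | "(i < r) \<noteq> (j < r)" by blast
    then show "(h \<boxplus> g) $$ (i, j) \<in> number_field z \<and> (h \<boxplus> g) $$ (i, j) = involution z ((h \<boxplus> g) $$ (j, i))"
    proof cases
      case 1
      then have eqs: "(h \<boxplus> g) $$ (i, j) = h $$ (i, j)" "(h \<boxplus> g) $$ (j, i) = h $$ (j, i)"
        using ij by (simp_all add: index)
      from h'[OF 1] show ?thesis unfolding eqs .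
    next
      case 2
      then have eqs: "(h \<boxplus> g) $$ (i, j) = g $$ (i - r, j - r)" "(h \<boxplus> g) $$ (j, i) = g $$ (j - r, i - r)"
        using ij by (simp_all add: index)
      from g'[OF 2] show ?thesis unfolding eqs .
    next
      case 3
      then have "(h \<boxplus> g) $$ (i, j) = 0" "(h \<boxplus> g) $$ (j, i) = 0"
        using ij by (auto simp: index)
      then show ?thesis by (simp add: number_field_0[OF z] involution_0[OF z])
    qed
  qed
  moreover have "det (h \<boxplus> g) \<noteq> 0" using h(2) g(2) by (simp add: det_dsum[OF h(1) g(1)])
  ultimately show ?thesis
    unfolding hermitian_lift_def K_def[symmetric]
    by (intro conjI exI[of _ \<chi>] ballI dsum_carrier h(1) g(1) bij add act trace)
qed


subsection \<open>The discriminant of a block sum\<close>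

text \<open>\<open>discriminant_of\<close> with the rank r exposed, since the sign for a block sum
  depends on the ranks.\<close>

definition discriminant_of_rank :: "int mat \<Rightarrow> complex \<Rightarrow> nat \<Rightarrow> complex \<Rightarrow> bool" where
  "discriminant_of_rank V z r \<delta> \<longleftrightarrow>
     (\<exists>n A T B\<^sub>0 T\<^sub>0 N B\<^sub>1 T\<^sub>1 h.
        A \<in> carrier_mat n n \<and> det A \<noteq> 0 \<and> s_equivalent (map_mat of_int V) A \<and>
        T \<in> carrier_mat n n \<and> A * T = transpose_mat A \<and>
        primary_part (min_poly z) (A + transpose_mat A) T B\<^sub>0 T\<^sub>0 \<and>
        isometric_structure N B\<^sub>1 T\<^sub>1 \<and> witt_equivalent B\<^sub>0 T\<^sub>0 B\<^sub>1 T\<^sub>1 \<and>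
        mat_poly (min_poly z) T\<^sub>1 = 0\<^sub>m N N \<and>
        hermitian_lift z N B\<^sub>1 T\<^sub>1 r h \<and>
        \<delta> = (-1) ^ (r * (r - 1) div 2) * det h)"

lemma discriminant_of_iff_rank: "discriminant_of V z \<delta> \<longleftrightarrow> (\<exists>r. discriminant_of_rank V z r \<delta>)"
  unfolding discriminant_of_def discriminant_of_rank_def by blast

lemma discriminant_of_rank_0: "discriminant_of_rank V z 0 \<delta> \<Longrightarrow> \<delta> = 1"
  by (auto simp: discriminant_of_rank_def hermitian_lift_def)

text \<open>Binomial coefficients: C(r + s, 2) = r s + C(r, 2) + C(s, 2). The term r s is the source
  of the sign in the additivity of discriminants; at 0 the truncated difference is multiplied by
  0.\<close>

lemma triangular_add:
  fixes r s :: nat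
  shows "(r + s) * (r + s - 1) div 2 = r * s + r * (r - 1) div 2 + s * (s - 1) div 2"
proof -
  have even: "even (n * (n - 1))" for n :: nat by (cases n) auto
  have "(r + s) * (r + s - 1) = 2 * (r * s) + r * (r - 1) + s * (s - 1)"
    by (cases r; cases s) (auto simp: algebra_simps)
  then show ?thesis using even[of r] even[of s] by (auto elim!: evenE)
qed

text \<open>Each ingredient of a choice is compatible with block sums, so any choices for V and W
  combine. Nothing is claimed about taking a choice for the sum apart.\<close>

lemma discriminant_of_rank_dsum:
  assumes z: "reciprocal z" and "discriminant_of_rank V z r \<delta>" "discriminant_of_rank W z s \<epsilon>"
    and V: "V \<in> carrier_mat k k" and W: "W \<in> carrier_mat l l"
  shows "discriminant_of_rank (V \<boxplus> W) z (r + s) ((-1) ^ (r * s) * \<delta> * \<epsilon>)"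
proof -
  let ?p = "min_poly z"
  obtain n A T B\<^sub>0 T\<^sub>0 N B\<^sub>1 T\<^sub>1 h where 1: "A \<in> carrier_mat n n" "det A \<noteq> 0"
    "s_equivalent (map_mat of_int V) A" "T \<in> carrier_mat n n" "A * T = transpose_mat A"
    "primary_part ?p (A + transpose_mat A) T B\<^sub>0 T\<^sub>0"
    "isometric_structure N B\<^sub>1 T\<^sub>1" "witt_equivalent B\<^sub>0 T\<^sub>0 B\<^sub>1 T\<^sub>1" "mat_poly ?p T\<^sub>1 = 0\<^sub>m N N"
    "hermitian_lift z N B\<^sub>1 T\<^sub>1 r h" "\<delta> = (-1) ^ (r * (r - 1) div 2) * det h"
    using assms(2) unfolding discriminant_of_rank_def by blast
  obtain n' A' T' C\<^sub>0 U\<^sub>0 N' C\<^sub>1 U\<^sub>1 g where 2: "A' \<in> carrier_mat n' n'" "det A' \<noteq> 0"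
    "s_equivalent (map_mat of_int W) A'" "T' \<in> carrier_mat n' n'" "A' * T' = transpose_mat A'"
    "primary_part ?p (A' + transpose_mat A') T' C\<^sub>0 U\<^sub>0"
    "isometric_structure N' C\<^sub>1 U\<^sub>1" "witt_equivalent C\<^sub>0 U\<^sub>0 C\<^sub>1 U\<^sub>1" "mat_poly ?p U\<^sub>1 = 0\<^sub>m N' N'"
    "hermitian_lift z N' C\<^sub>1 U\<^sub>1 s g" "\<epsilon> = (-1) ^ (s * (s - 1) div 2) * det g"
    using assms(3) unfolding discriminant_of_rank_def by blast
  have B\<^sub>1: "B\<^sub>1 \<in> carrier_mat N N" "T\<^sub>1 \<in> carrier_mat N N" "C\<^sub>1 \<in> carrier_mat N' N'" "U\<^sub>1 \<in> carrier_mat N' N'"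
    using 1(7) 2(7) by (auto simp: isometric_structure_def)
  obtain a where a: "B\<^sub>0 \<in> carrier_mat a a" "T\<^sub>0 \<in> carrier_mat a a"
    using 1(6) by (rule primary_part_carrier)
  obtain b where b: "C\<^sub>0 \<in> carrier_mat b b" "U\<^sub>0 \<in> carrier_mat b b"
    using 2(6) by (rule primary_part_carrier)
  have hg: "h \<in> carrier_mat r r" "g \<in> carrier_mat s s"
    using 1(10) 2(10) by (auto simp: hermitian_lift_def)
  have "det (A \<boxplus> A') \<noteq> 0" using 1(2) 2(2) by (simp add: det_dsum[OF 1(1) 2(1)])
  moreover have "s_equivalent (map_mat of_int (V \<boxplus> W)) (A \<boxplus> A')"
    unfolding map_mat_dsum[where f = of_int, OF of_int_0]
    by (rule s_equivalent_dsum[OF 1(3) 2(3) _ 1(1) _ 2(1)]) (use V W in auto)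
  moreover have "(A \<boxplus> A') * (T \<boxplus> T') = transpose_mat (A \<boxplus> A')"
    by (simp add: mult_dsum[OF 1(1,4) 2(1,4)] 1(5) 2(5) transpose_dsum)
  moreover have "primary_part ?p ((A \<boxplus> A') + transpose_mat (A \<boxplus> A')) (T \<boxplus> T') (B\<^sub>0 \<boxplus> C\<^sub>0) (T\<^sub>0 \<boxplus> U\<^sub>0)"
    using primary_part_dsum[OF 1(6) 2(6)] 1(1) 2(1) by (simp add: transpose_dsum add_dsum)
  moreover have "witt_equivalent (B\<^sub>0 \<boxplus> C\<^sub>0) (T\<^sub>0 \<boxplus> U\<^sub>0) (B\<^sub>1 \<boxplus> C\<^sub>1) (T\<^sub>1 \<boxplus> U\<^sub>1)"
    by (rule witt_equivalent_dsum[OF 1(8) 2(8) a B\<^sub>1(1,2) b B\<^sub>1(3,4)])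
  moreover have "mat_poly ?p (T\<^sub>1 \<boxplus> U\<^sub>1) = 0\<^sub>m (N + N') (N + N')"
    by (simp add: mat_poly_dsum[OF B\<^sub>1(2,4)] 1(9) 2(9) dsum_zero)
  moreover have "(-1) ^ (r * s) * \<delta> * \<epsilon> = (-1) ^ ((r + s) * (r + s - 1) div 2) * det (h \<boxplus> g)"
    unfolding triangular_add by (simp add: 1(11) 2(11) det_dsum[OF hg] power_add)
  ultimately show ?thesis
    unfolding discriminant_of_rank_def
    using dsum_carrier[OF 1(1) 2(1)] dsum_carrier[OF 1(4) 2(4)] isometric_structure_dsum[OF 1(7) 2(7)]
      hermitian_lift_dsum[OF z 1(10) 2(10) B\<^sub>1]
    by blast
qed


subsection \<open>Two-by-two matrices\<close>

definition mat2 :: "'a \<Rightarrow> 'a \<Rightarrow> 'a \<Rightarrow> 'a \<Rightarrow> 'a mat" where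
  "mat2 a b c d = mat 2 2 (\<lambda>(i, j). if i = 0 then if j = 0 then a else b else if j = 0 then c else d)"

lemma mat2_carrier [simp]: "mat2 a b c d \<in> carrier_mat 2 2"
  by (simp add: mat2_def)

lemma dim_mat2 [simp]: "dim_row (mat2 a b c d) = 2" "dim_col (mat2 a b c d) = 2"
  by (simp_all add: mat2_def)

lemma index_mat2 [simp]:
  "mat2 a b c d $$ (0, 0) = a" "mat2 a b c d $$ (0, Suc 0) = b"
  "mat2 a b c d $$ (Suc 0, 0) = c" "mat2 a b c d $$ (Suc 0, Suc 0) = d"
  by (simp_all add: mat2_def)

lemma mat2_eqI:
  assumes "M \<in> carrier_mat 2 2" "M $$ (0, 0) = a" "M $$ (0, Suc 0) = b"
    "M $$ (Suc 0, 0) = c" "M $$ (Suc 0, Suc 0) = d"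
  shows "M = mat2 a b c d"
proof (rule eq_matI)
  fix i j assume "i < dim_row (mat2 a b c d)" "j < dim_col (mat2 a b c d)"
  then have "i = 0 \<or> i = Suc 0" "j = 0 \<or> j = Suc 0" by auto
  then show "M $$ (i, j) = mat2 a b c d $$ (i, j)" using assms by auto
qed (use assms in auto)

lemma sum_less_2: "(\<Sum>i = 0..<2. g i) = g 0 + g (Suc 0)"
  by (simp add: numeral_2_eq_2)

lemma mat2_mult: "mat2 a b c d * mat2 a' b' c' d' =
    mat2 (a * a' + b * c') (a * b' + b * d') (c * a' + d * c') (c * b' + d * d' :: 'a::comm_ring_1)"
  by (rule mat2_eqI) (auto simp: scalar_prod_def sum_less_2)

lemma mat2_add: "mat2 a b c d + mat2 a' b' c' d' = mat2 (a + a') (b + b') (c + c') (d + d' :: 'a::plus)"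
  by (rule mat2_eqI) auto

lemma mat2_minus: "mat2 a b c d - mat2 a' b' c' d' = mat2 (a - a') (b - b') (c - c') (d - d' :: 'a::minus)"
  by (rule mat2_eqI) auto

lemma mat2_smult: "x \<cdot>\<^sub>m mat2 a b c d = mat2 (x * a) (x * b) (x * c) (x * d :: 'a::times)"
  by (rule mat2_eqI) auto

lemma mat2_transpose: "transpose_mat (mat2 a b c d) = mat2 a c b d"
  by (rule mat2_eqI) auto

lemma mat2_map: "map_mat f (mat2 a b c d) = mat2 (f a) (f b) (f c) (f d)"
  by (rule mat2_eqI) auto

lemma mat2_one: "1\<^sub>m 2 = mat2 1 0 0 1"
  by (rule mat2_eqI) auto

lemma mat2_zero: "0\<^sub>m 2 2 = mat2 0 0 0 0"
  by (rule mat2_eqI) auto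

lemma mat2_det: "det (mat2 a b c d) = a * d - b * (c :: 'a::comm_ring_1)"
  by (simp add: det_dim2)

lemmas mat2_simps = mat2_mult mat2_add mat2_minus mat2_smult mat2_transpose mat2_map mat2_one mat2_zero mat2_det


subsection \<open>The twist knots\<close>

text \<open>The signs 1 and -1 give the Seifert matrices of T_n and of its concordance inverse, so
  that positive and negative multiples are treated at once.\<close>

definition signed_twist_knot :: "int \<Rightarrow> nat \<Rightarrow> int mat" where
  "signed_twist_knot \<epsilon> n = \<epsilon> \<cdot>\<^sub>m twist_knot n"

lemma signed_twist_knot_mat2: "signed_twist_knot \<epsilon> n = mat2 (- \<epsilon>) \<epsilon> 0 (\<epsilon> * int n)"
  by (rule mat2_eqI) (auto simp: signed_twist_knot_def twist_knot_def mat_of_rows_list_def)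

lemma twist_knot_signed:
  "twist_knot n = signed_twist_knot 1 n" "concordance_inverse (twist_knot n) = signed_twist_knot (-1) n"
  by (auto simp: signed_twist_knot_def concordance_inverse_def intro!: eq_matI)

text \<open>For positive n, the Alexander polynomial n t^2 - (2 n + 1) t + n made monic.\<close>

definition twist_poly :: "nat \<Rightarrow> rat poly" where
  "twist_poly n = [:1, - (2 + 1 / of_nat n), 1:]"

text \<open>This is the inverse of A times its transpose for a Seifert matrix A of T_n with n
  positive. The sign of A cancels, so it belongs to the concordance inverse as well.\<close>

definition twist_isometry :: "nat \<Rightarrow> rat mat" where
  "twist_isometry n = mat2 (1 + 1 / of_nat n) 1 (1 / of_nat n) 1"

lemma twist_isometry_carrier [simp]: "twist_isometry n \<in> carrier_mat 2 2"
  by (simp add: twist_isometry_def)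

lemma twist_isometry_eq:
  assumes "n \<ge> 1"
  shows "map_mat of_int (signed_twist_knot \<epsilon> n) * twist_isometry n
      = transpose_mat (map_mat of_int (signed_twist_knot \<epsilon> n))"
  unfolding signed_twist_knot_mat2 twist_isometry_def mat2_simps
  using assms by (intro arg_cong4[where f = mat2]) (simp_all add: distrib_left)

text \<open>An instance of Cayley-Hamilton: the isometry has trace 2 + 1/n and determinant
  1.\<close>

lemma mat_poly_twist_poly: "mat_poly (twist_poly n) (twist_isometry n) = 0\<^sub>m 2 2"
proof -
  note T = twist_isometry_carrier[of n]
  have "k \<cdot>\<^sub>m 1\<^sub>m 2 + 0\<^sub>m 2 2 * M = k \<cdot>\<^sub>m 1\<^sub>m 2" if "M \<in> carrier_mat 2 2" for k and M :: "rat mat"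
    using that by simp
  then have "mat_poly (twist_poly n) (twist_isometry n) =
      1 \<cdot>\<^sub>m 1\<^sub>m 2 + (- (2 + 1 / of_nat n) \<cdot>\<^sub>m 1\<^sub>m 2 + 1 \<cdot>\<^sub>m 1\<^sub>m 2 * twist_isometry n) * twist_isometry n"
    by (simp only: twist_poly_def mat_poly_pCons[OF T] mat_poly_0[OF T] T)
  also have "\<dots> = 0\<^sub>m 2 2"
    unfolding twist_isometry_def mat2_simps
    by (rule arg_cong4[where f = mat2]) (simp_all add: algebra_simps)
  finally show ?thesis .
qed

lemma rpoly_twist_poly: "rpoly (twist_poly n) w = w\<^sup>2 - (2 + 1 / of_nat n) * w + 1"
proof -
  define c :: rat where "c = 2 + 1 / of_nat n"
  have "of_rat c = (2 + 1 / of_nat n :: complex)"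
    by (simp add: c_def of_rat_add of_rat_divide)
  then show ?thesis
    unfolding twist_poly_def c_def[symmetric]
    by (simp add: rpoly_simps of_rat_minus algebra_simps power2_eq_square)
qed

text \<open>Subtracting the two quadratic equations leaves (1/m - 1/n) z = 0.\<close>

lemma twist_poly_root_unique:
  assumes "rpoly (twist_poly m) z = 0" "rpoly (twist_poly n) z = 0" "m \<ge> 1" "n \<ge> 1"
  shows "m = n"
proof -
  have "z \<noteq> 0" using assms(1) by (auto simp: rpoly_twist_poly)
  moreover have "(1 / of_nat m - 1 / of_nat n) * z = 0"
    using assms(1,2) unfolding rpoly_twist_poly by (simp add: algebra_simps)
  ultimately show ?thesis by simp
qed

section \<open>The quadratic field of a reciprocal root of \<open>twist_poly\<close>\<close>

context
  fixes n :: nat and z :: complex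
  assumes n: "n \<ge> 1" and z: "reciprocal z" and root: "rpoly (twist_poly n) z = 0"
begin

lemma twist_root_plus_inverse: "z + inverse z = 2 + 1 / of_nat n"
proof -
  have "z * (z + inverse z) = z * (2 + 1 / of_nat n)"
    using root reciprocal_nonzero[OF z] unfolding rpoly_twist_poly
    by (simp add: algebra_simps power2_eq_square)
  then show ?thesis using reciprocal_nonzero[OF z] by simp
qed

text \<open>Otherwise z would be 1 or -1 and z + 1/z would be 2 or -2, but it is 2 + 1/n.\<close>

lemma twist_root_neq_inverse: "z \<noteq> inverse z"
proof
  assume *: "z = inverse z"
  then have "z * z = 1" using reciprocal_nonzero[OF z] by (metis right_inverse)
  then have "z = 1 \<or> z = -1" by (simp add: square_eq_1_iff)
  then show False
  proof
    assume "z = 1"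
    then show False using twist_root_plus_inverse n by simp
  next
    assume "z = -1"
    then have "- 2 = (2 + 1 / of_nat n :: complex)" using twist_root_plus_inverse by simp
    then have "Re (- 2) = Re (2 + 1 / of_nat n)" by (rule arg_cong)
    then have "(0::real) = 4 + 1 / real n" by simp
    moreover have "1 / real n \<ge> 0" by simp
    ultimately show False by linarith
  qed
qed

text \<open>A linear minimal polynomial would have both z and 1/z as its only root. For n = k (k +
  1) the polynomial does split over Q, with roots (k + 1)/k and k/(k + 1), but reciprocity of z
  rules these out.\<close>

lemma min_poly_twist: "min_poly z = twist_poly n"
proof -
  let ?p = "min_poly z"
  obtain g where g: "twist_poly n = ?p * g"
    using root by (metis min_poly_dvd_iff[OF z] dvdE)
  have q: "degree (twist_poly n) = 2" "lead_coeff (twist_poly n) = 1" by (simp_all add: twist_poly_def)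
  have nz: "?p \<noteq> 0" "g \<noteq> 0" using g q by auto
  then have deg: "degree ?p + degree g = 2" using q g degree_mult_eq[OF nz] by simp
  have lc: "lead_coeff g = 1" using q(2) min_poly_monic[OF z] unfolding g by (simp add: lead_coeff_mult)
  have "degree ?p \<noteq> 0"
    using min_poly_irreducible[OF z] by (metis irreducible_def is_unit_iff_degree)
  moreover have "degree ?p \<noteq> 1"
  proof
    assume "degree ?p = 1"
    then have "?p = [:coeff ?p 0, coeff ?p 1:]"
      by (intro poly_eqI) (auto simp: coeff_pCons coeff_eq_0 split: nat.splits)
    then obtain a b where ab: "?p = [:a, b:]" by blast
    have "b = 1" using min_poly_monic[OF z] \<open>degree ?p = 1\<close> ab by simp
    then have "of_rat a + z = 0" "of_rat a + inverse z = 0"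
      using min_poly_root[OF z] min_poly_root_inverse[OF z] ab by (simp_all add: rpoly_simps)
    then have "z = inverse z" by (metis add_left_cancel)
    then show False using twist_root_neq_inverse by simp
  qed
  ultimately have "degree g = 0" using deg by linarith
  then obtain c where "g = [:c:]" by (metis degree_eq_zeroE)
  then show ?thesis using lc g by simp
qed

text \<open>The minimal polynomial has degree 2, so 1 and z are independent over Q. This gives
  injectivity of the identification of the rational plane with the field.\<close>

lemma twist_field_unique:
  assumes "of_rat a + of_rat b * z = 0" shows "a = 0 \<and> b = 0"
proof -
  have "min_poly z dvd [:a, b:]"
    unfolding min_poly_dvd_iff[OF z] using assms by (simp add: rpoly_simps mult.commute)
  then have "twist_poly n dvd [:a, b:]" by (simp add: min_poly_twist)
  then have "[:a, b:] = 0 \<or> degree (twist_poly n) \<le> degree [:a, b:]"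
    by (metis dvd_imp_degree_le)
  then show ?thesis by (auto simp: twist_poly_def split: if_splits)
qed

lemma twist_number_fieldE:
  assumes "u \<in> number_field z"
  obtains a b where "u = of_rat a + of_rat b * z"
proof -
  obtain p where p: "u = rpoly p z" using assms by (rule number_fieldE[OF z])
  define g where "g = p mod twist_poly n"
  have "p = p div twist_poly n * twist_poly n + g" by (simp add: g_def)
  then have "u = rpoly (p div twist_poly n * twist_poly n + g) z" using p by simp
  then have u: "u = rpoly g z" by (simp add: rpoly_simps root)
  have "g = 0 \<or> degree g < degree (twist_poly n)"
    unfolding g_def by (rule degree_mod_less) (simp add: twist_poly_def)
  then have "degree g < 2" by (auto simp: twist_poly_def)
  then have "g = [:coeff g 0, coeff g 1:]"
    by (intro poly_eqI) (auto simp: coeff_pCons coeff_eq_0 split: nat.splits)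
  then have "u = rpoly [:coeff g 0, coeff g 1:] z" using u by simp
  then have "u = of_rat (coeff g 0) + of_rat (coeff g 1) * z" by (simp add: rpoly_simps mult.commute)
  then show ?thesis by (rule that)
qed

text \<open>The conjugates of z are z and 1/z, and they differ.\<close>

lemma twist_field_trace: "of_rat (field_trace z (rpoly p z)) = rpoly p z + rpoly p (inverse z)"
proof -
  have "rpoly (twist_poly n) w = (w - z) * (w - inverse z)" for w
  proof -
    have "(w - z) * (w - inverse z) = w\<^sup>2 - (z + inverse z) * w + z * inverse z"
      by (simp add: algebra_simps power2_eq_square)
    then show ?thesis using reciprocal_nonzero[OF z] by (simp add: rpoly_twist_poly twist_root_plus_inverse)
  qed
  then have "{w. rpoly (min_poly z) w = 0} = {z, inverse z}" by (auto simp: min_poly_twist)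
  then show ?thesis using twist_root_neq_inverse by (simp add: of_rat_field_trace[OF z])
qed

text \<open>The isometry has the left eigenvector \<open>(1, n z - (n + 1))\<close> with eigenvalue \<open>z\<close>, which identifies
  the rational plane with the field; the Hermitian form is then the constant \<open>- \<epsilon>\<close>.\<close>

lemma hermitian_lift_twist:
  assumes \<epsilon>: "\<epsilon> = 1 \<or> \<epsilon> = (-1 :: rat)"
  shows "hermitian_lift z 2 (mat2 (- 2 * \<epsilon>) \<epsilon> \<epsilon> (2 * of_nat n * \<epsilon>)) (twist_isometry n) 1
    (mat 1 1 (\<lambda>_. of_rat (- \<epsilon>)))"
proof -
  let ?B = "mat2 (- 2 * \<epsilon>) \<epsilon> \<epsilon> (2 * of_nat n * \<epsilon>)"
  \<comment> \<open>The pairing of v with the left eigenvector, kept as a polynomial in z so that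
    the involution can be evaluated by inserting 1/z.\<close>
  define G :: "rat vec \<Rightarrow> rat poly" where
    "G v = [:v $ 0 - (of_nat n + 1) * v $ 1, of_nat n * v $ 1:]" for v
  define f where "f v = vec 1 (\<lambda>_. rpoly (G v) z)" for v
  have n0: "of_nat n \<noteq> (0 :: rat)" "of_nat n \<noteq> (0 :: complex)" using n by auto
  have G: "rpoly (G v) w = of_rat (v $ 0 - (of_nat n + 1) * v $ 1) + of_rat (of_nat n * v $ 1) * w" for v w
    by (simp add: G_def rpoly_simps mult.commute)
  have square: "of_nat n * (z * z) = (2 * of_nat n + 1) * z - of_nat n"
  proof -
    have "of_nat n * (z * z) - ((2 * of_nat n + 1) * z - of_nat n) =
        of_nat n * (z\<^sup>2 - (2 + 1 / of_nat n) * z + 1)"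
      using n0 by (simp add: algebra_simps power2_eq_square)
    then show ?thesis using root unfolding rpoly_twist_poly by simp
  qed
  let ?K = "{x \<in> carrier_vec 1. \<forall>i<1. x $ i \<in> number_field z}"
  have bij: "bij_betw f (carrier_vec 2) ?K"
  proof (rule bij_betwI')
    fix v w :: "rat vec" assume vw: "v \<in> carrier_vec 2" "w \<in> carrier_vec 2"
    show "f v = f w \<longleftrightarrow> v = w"
    proof
      assume "f v = f w"
      then have "rpoly (G v) z = rpoly (G w) z" by (auto simp: f_def dest: arg_cong[of _ _ "\<lambda>x. vec_index x 0"])
      then have "rpoly (G v - G w) z = 0" by (simp add: rpoly_simps)
      then have "of_rat (v $ 0 - (of_nat n + 1) * v $ 1 - (w $ 0 - (of_nat n + 1) * w $ 1))
          + of_rat (of_nat n * v $ 1 - of_nat n * w $ 1) * z = 0"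
        by (simp add: G_def rpoly_simps mult.commute)
      from twist_field_unique[OF this] have "v $ 1 = w $ 1" "v $ 0 = w $ 0" using n0 by auto
      then show "v = w" using vw by (intro eq_vecI) (auto simp: less_2_cases_iff)
    qed simp
  next
    fix v :: "rat vec" assume "v \<in> carrier_vec 2"
    then show "f v \<in> ?K" by (simp add: f_def number_fieldI[OF z])
  next
    fix x assume x: "x \<in> ?K"
    then obtain a b where ab: "x $ 0 = of_rat a + of_rat b * z" by (auto elim: twist_number_fieldE)
    \<comment> \<open>Solves a = v_0 - (n + 1) v_1 and b = n v_1.\<close>
    define v where "v = vec 2 (\<lambda>i. if i = 0 then a + (of_nat n + 1) * (b / of_nat n) else b / of_nat n)"
    have "f v = x" using x n0 ab by (intro eq_vecI) (auto simp: f_def G v_def)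
    then show "\<exists>v\<in>carrier_vec 2. x = f v" by (intro bexI[of _ v]) (auto simp: v_def)
  qed
  have add: "f (v + w) = f v + f w" if "v \<in> carrier_vec 2" "w \<in> carrier_vec 2" for v w
    using that by (intro eq_vecI) (auto simp: f_def G of_rat_add of_rat_diff of_rat_mult algebra_simps)
  have act: "f (twist_isometry n *\<^sub>v v) = z \<cdot>\<^sub>v f v" if v: "v \<in> carrier_vec 2" for v
  proof -
    have Tv: "(twist_isometry n *\<^sub>v v) $ 0 = (1 + 1 / of_nat n) * v $ 0 + v $ 1"
      "(twist_isometry n *\<^sub>v v) $ 1 = 1 / of_nat n * v $ 0 + v $ 1"
      using v by (auto simp: twist_isometry_def scalar_prod_def sum_less_2)
    have "rpoly (G (twist_isometry n *\<^sub>v v)) z = z * rpoly (G v) z"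
    proof -
      have "rpoly (G (twist_isometry n *\<^sub>v v)) z = of_rat (v $ 0) * z + of_rat (v $ 1) * (of_nat n * z - of_nat n)"
      proof -
        have "(1 + 1 / of_nat n) * v $ 0 + v $ 1 - (of_nat n + 1) * (1 / of_nat n * v $ 0 + v $ 1) = - of_nat n * v $ 1"
          "of_nat n * (1 / of_nat n * v $ 0 + v $ 1) = v $ 0 + of_nat n * v $ 1"
          using n0 by (simp_all add: algebra_simps)
        then show ?thesis
          unfolding G Tv by (simp add: of_rat_add of_rat_minus of_rat_mult algebra_simps)
      qed
      \<comment> \<open>The second entry of the left eigenvector equation, read off the quadratic
        equation for z.\<close>
      also have "of_nat n * z - of_nat n = of_nat n * (z * z) - (of_nat n + 1) * z"
        unfolding square by (simp add: algebra_simps)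
      also have "of_rat (v $ 0) * z + of_rat (v $ 1) * (of_nat n * (z * z) - (of_nat n + 1) * z) = z * rpoly (G v) z"
        unfolding G by (simp add: of_rat_add of_rat_diff of_rat_mult algebra_simps)
      finally show ?thesis .
    qed
    then show ?thesis by (intro eq_vecI) (auto simp: f_def)
  qed
  have trace: "v \<bullet> (?B *\<^sub>v w) = field_trace z (f v \<bullet> (mat 1 1 (\<lambda>_. of_rat (- \<epsilon>)) *\<^sub>v map_vec (involution z) (f w)))"
    if v: "v \<in> carrier_vec 2" and w: "w \<in> carrier_vec 2" for v w
  proof -
    define a b c d where "a = v $ 0 - (of_nat n + 1) * v $ 1" and "b = of_nat n * v $ 1"
      and "c = w $ 0 - (of_nat n + 1) * w $ 1" and "d = of_nat n * w $ 1"
    define s :: rat where "s = 2 + 1 / of_nat n"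
    have s: "z + inverse z = of_rat s"
      using twist_root_plus_inverse by (simp add: s_def of_rat_add of_rat_divide)
    then have iz: "inverse z = of_rat s - z" by (simp add: algebra_simps)
    have zz: "z * (of_rat s - z) = 1" using reciprocal_nonzero[OF z] unfolding iz[symmetric] by simp
    \<comment> \<open>The values of f are a + b z at v and c + d z at w. The conjugate c + d/z is
      written as c + d (s - z), since 1/z = s - z, so that p takes the Hermitian value at z and its
      conjugate at 1/z.\<close>
    define p where "p = Polynomial.smult (- \<epsilon>) ([:a, b:] * [:c + d * s, - d:])"
    have p: "rpoly p x = - of_rat \<epsilon> * ((of_rat a + of_rat b * x) * (of_rat c + of_rat d * (of_rat s - x)))" for x
      unfolding p_def
      by (simp add: rpoly_simps of_rat_hom.map_poly_hom_smult of_rat_add of_rat_diff of_rat_mult of_rat_minus algebra_simps)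
    have "f v \<bullet> (mat 1 1 (\<lambda>_. of_rat (- \<epsilon>)) *\<^sub>v map_vec (involution z) (f w))
        = rpoly (G v) z * (of_rat (- \<epsilon>) * rpoly (G w) (inverse z))"
      by (simp add: f_def scalar_prod_def involution_rpoly[OF z])
    also have "\<dots> = rpoly p z"
      unfolding G p iz a_def[symmetric] b_def[symmetric] c_def[symmetric] d_def[symmetric]
      by (simp add: of_rat_minus)
    finally have "of_rat (field_trace z (f v \<bullet> (mat 1 1 (\<lambda>_. of_rat (- \<epsilon>)) *\<^sub>v map_vec (involution z) (f w))))
        = rpoly p z + rpoly p (inverse z)" by (simp only: twist_field_trace)
    also have "\<dots> = - of_rat \<epsilon> * (2 * of_rat a * of_rat c + 2 * of_rat b * of_rat d * (z * (of_rat s - z))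
        + (of_rat a * of_rat d + of_rat b * of_rat c) * of_rat s)"
      unfolding p iz by (simp add: algebra_simps)
    also have "\<dots> = of_rat (- \<epsilon> * (2 * a * c + 2 * b * d + (a * d + b * c) * s))"
      unfolding zz by (simp add: of_rat_add of_rat_mult of_rat_minus)
    also have "- \<epsilon> * (2 * a * c + 2 * b * d + (a * d + b * c) * s) = v \<bullet> (?B *\<^sub>v w)"
    proof -
      have "v \<bullet> (?B *\<^sub>v w) = \<epsilon> * (- 2 * v $ 0 * w $ 0 + v $ 0 * w $ 1 + v $ 1 * w $ 0 + 2 * of_nat n * v $ 1 * w $ 1)"
        using v w by (simp add: scalar_prod_def sum_less_2 algebra_simps)
      moreover have "2 * a * c + 2 * b * d + (a * d + b * c) * s
          = - (- 2 * v $ 0 * w $ 0 + v $ 0 * w $ 1 + v $ 1 * w $ 0 + 2 * of_nat n * v $ 1 * w $ 1)"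
      proof -
        have "b * s = 2 * b + v $ 1" "d * s = 2 * d + w $ 1"
          unfolding b_def d_def s_def using n0 by (simp_all add: algebra_simps)
        moreover have "(a * d + b * c) * s = a * (d * s) + (b * s) * c" by (simp add: algebra_simps)
        ultimately show ?thesis unfolding a_def b_def c_def d_def by (simp add: algebra_simps)
      qed
      ultimately show ?thesis by (simp only: minus_mult_minus)
    qed
    finally show ?thesis by simp
  qed
  have "of_rat c \<in> number_field z" "involution z (of_rat c) = of_rat c" for c
    using number_fieldI[OF z, of "[:c:]"] involution_rpoly[OF z, of "[:c:]"] by (simp_all add: rpoly_simps)
  then have "\<forall>i<1. \<forall>j<1. mat 1 1 (\<lambda>_. of_rat (- \<epsilon>)) $$ (i, j) \<in> number_field z \<and>
      mat 1 1 (\<lambda>_. of_rat (- \<epsilon>)) $$ (i, j) = involution z (mat 1 1 (\<lambda>_. of_rat (- \<epsilon>)) $$ (j, i))"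
    by simp
  moreover have "det (mat 1 1 (\<lambda>_. of_rat (- \<epsilon>))) \<noteq> (0 :: complex)"
    using \<epsilon> by (auto simp: det_single)
  ultimately show ?thesis
    unfolding hermitian_lift_def
    by (intro conjI exI[of _ f] ballI bij add act trace) simp
qed

text \<open>The minimal polynomial already kills the isometry, so the whole rational plane is
  z-primary. It serves as its own Witt representative, with the identity matrix as basis and a form
  of rank 1 over Q(z).\<close>

lemma discriminant_of_rank_twist_root:
  assumes \<epsilon>: "\<epsilon> = 1 \<or> \<epsilon> = (-1 :: int)"
  shows "\<exists>\<delta>. discriminant_of_rank (signed_twist_knot \<epsilon> n) z 1 \<delta>"
proof -
  define A :: "rat mat" where "A = map_mat of_int (signed_twist_knot \<epsilon> n)"
  let ?T = "twist_isometry n" and ?e = "of_int \<epsilon> :: rat"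
  let ?B = "mat2 (- 2 * ?e) ?e ?e (2 * of_nat n * ?e)"
  have A: "A = mat2 (- ?e) ?e 0 (?e * of_nat n)"
    by (simp add: A_def signed_twist_knot_mat2 mat2_map)
  have B: "A + transpose_mat A = ?B"
    unfolding A mat2_simps by (intro arg_cong4[where f = mat2]) auto
  have "det A \<noteq> 0" using \<epsilon> n unfolding A mat2_simps by auto
  moreover have iso: "isometric_structure 2 ?B ?T"
    unfolding isometric_structure_def twist_isometry_def mat2_simps
  proof (intro conjI)
    \<comment> \<open>The symmetrized form has determinant -(4 n + 1), because the sign squares to
      1.\<close>
    have "- 2 * ?e * (2 * of_nat n * ?e) - ?e * ?e = - (4 * of_nat n + 1) * (?e * ?e)"
      by (simp add: algebra_simps)
    moreover have "4 * rat_of_nat n + 1 \<noteq> 0"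
    proof -
      have "4 * rat_of_nat n + 1 = of_nat (4 * n + 1)" by simp
      also have "\<dots> \<noteq> 0" unfolding of_nat_eq_0_iff by simp
      finally show ?thesis .
    qed
    ultimately show "- 2 * ?e * (2 * of_nat n * ?e) - ?e * ?e \<noteq> 0" using \<epsilon> by auto
    show "mat2 (- 2 * ?e) ?e ?e (2 * of_nat n * ?e) = mat2 (- 2 * ?e) ?e ?e (2 * of_nat n * ?e)" ..
  qed (use n in \<open>auto intro!: arg_cong4[where f = mat2] simp: algebra_simps\<close>)
  moreover have "primary_part (min_poly z) ?B ?T ?B ?T"
    unfolding primary_part_def
  proof (intro exI conjI)
    have "(mat_poly (min_poly z) ?T ^\<^sub>m 1) *\<^sub>v v = 0\<^sub>v 2" if "v \<in> carrier_vec 2" for v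
      using that by (auto simp: min_poly_twist mat_poly_twist_poly scalar_prod_def intro!: eq_vecI)
    then have kernel: "{v \<in> carrier_vec 2. \<exists>e. (mat_poly (min_poly z) ?T ^\<^sub>m e) *\<^sub>v v = 0\<^sub>v 2} = carrier_vec 2"
      by blast
    have "{1\<^sub>m 2 *\<^sub>v x | x. x \<in> carrier_vec 2} = (\<lambda>x. 1\<^sub>m 2 *\<^sub>v x) ` (carrier_vec 2 :: rat vec set)" by blast
    also have "\<dots> = carrier_vec 2" by (simp cong: image_cong)
    finally show "{1\<^sub>m 2 *\<^sub>v x | x. x \<in> carrier_vec 2} =
        {v \<in> carrier_vec 2. \<exists>e. (mat_poly (min_poly z) ?T ^\<^sub>m e) *\<^sub>v v = 0\<^sub>v 2}"
      unfolding kernel .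
    show "injective_mat (1\<^sub>m 2)" by (auto simp: injective_mat_def)
    show "?T * 1\<^sub>m 2 = 1\<^sub>m 2 * ?T"
      using left_mult_one_mat[OF twist_isometry_carrier] right_mult_one_mat[OF twist_isometry_carrier] by simp
    show "?B = transpose_mat (1\<^sub>m 2) * ?B * 1\<^sub>m 2"
      unfolding mat2_simps by simp
  qed auto
  moreover have "witt_equivalent ?B ?T ?B ?T" by (rule witt_equivalent_refl[of _ 2]) auto
  moreover have "mat_poly (min_poly z) ?T = 0\<^sub>m 2 2" by (simp add: min_poly_twist mat_poly_twist_poly)
  moreover have "hermitian_lift z 2 ?B ?T 1 (mat 1 1 (\<lambda>_. of_rat (- ?e)))"
    using \<epsilon> by (intro hermitian_lift_twist) auto
  moreover have "A * ?T = transpose_mat A" unfolding A_def by (rule twist_isometry_eq[OF n])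
  moreover have "A \<in> carrier_mat 2 2" by (simp add: A)
  ultimately show ?thesis
    unfolding discriminant_of_rank_def A_def[symmetric]
    using s_equivalent_refl[of A] twist_isometry_carrier[of n] unfolding B[symmetric] by blast
qed

end

section \<open>Trivial primary parts\<close>

lemma carrier_vec_0: "carrier_vec 0 = {0\<^sub>v 0}"
  by (auto intro!: eq_vecI)

text \<open>Since p(T) is invertible, only 0 is killed by a power of it. The primary part has
  dimension 0, its basis matrix has no columns, and the discriminant is an empty
  determinant.\<close>

lemma discriminant_of_rank_trivial:
  assumes z: "reciprocal z" and V: "V \<in> carrier_mat n n" "det (map_mat rat_of_int V) \<noteq> 0"
    and T: "T \<in> carrier_mat n n" "map_mat rat_of_int V * T = transpose_mat (map_mat rat_of_int V)"
    and M: "M \<in> carrier_mat n n" "M * mat_poly (min_poly z) T = 1\<^sub>m n"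
  shows "discriminant_of_rank V z 0 1"
proof -
  let ?A = "map_mat rat_of_int V" and ?p = "mat_poly (min_poly z) T"
  let ?E = "0\<^sub>m 0 0 :: rat mat"
  have pT: "?p \<in> carrier_mat n n" using T by auto
  have "v = 0\<^sub>v n" if "(?p ^\<^sub>m e) *\<^sub>v v = 0\<^sub>v n" "v \<in> carrier_vec n" for e v
    using that
  proof (induction e arbitrary: v)
    case 0
    then show ?case using pT by auto
  next
    case (Suc e)
    have "(?p ^\<^sub>m e) *\<^sub>v (?p *\<^sub>v v) = 0\<^sub>v n"
      using Suc.prems pT assoc_mult_mat_vec[of "?p ^\<^sub>m e" n n ?p n v] by simp
    then have "?p *\<^sub>v v = 0\<^sub>v n" using Suc.IH Suc.prems(2) pT by auto
    then have "M *\<^sub>v (?p *\<^sub>v v) = 0\<^sub>v n" using M(1) by auto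
    then show ?case using assoc_mult_mat_vec[OF M(1) pT Suc.prems(2)] M(2) Suc.prems(2) by simp
  qed
  then have kernel: "{v \<in> carrier_vec n. \<exists>e. (?p ^\<^sub>m e) *\<^sub>v v = 0\<^sub>v n} = {0\<^sub>v n}"
    using pT by (auto intro!: exI[of _ 0])
  have "primary_part (min_poly z) (?A + transpose_mat ?A) T ?E ?E"
    unfolding primary_part_def
  proof (intro exI conjI)
    have "0\<^sub>m n 0 *\<^sub>v x = 0\<^sub>v n" if "x \<in> carrier_vec 0" for x :: "rat vec"
      using that by (auto simp: scalar_prod_def intro!: eq_vecI)
    then show "{0\<^sub>m n 0 *\<^sub>v x | x. x \<in> carrier_vec 0} =
        {v \<in> carrier_vec n. \<exists>e. (?p ^\<^sub>m e) *\<^sub>v v = 0\<^sub>v n}"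
      unfolding kernel by (auto intro!: exI[of _ "0\<^sub>v 0"])
    show "injective_mat (0\<^sub>m n 0)" by (auto simp: injective_mat_def)
    show "T * 0\<^sub>m n 0 = 0\<^sub>m n 0 * ?E" using T by auto
    show "?E = transpose_mat (0\<^sub>m n 0) * (?A + transpose_mat ?A) * 0\<^sub>m n 0" using V by auto
  qed (use T V in auto)
  moreover have "isometric_structure 0 ?E ?E" by (auto simp: isometric_structure_def)
  moreover have "witt_equivalent ?E ?E ?E ?E" by (rule witt_equivalent_refl[of _ 0]) auto
  moreover have "mat_poly (min_poly z) ?E = 0\<^sub>m 0 0" by (auto simp: mat_poly_def)
  moreover have "hermitian_lift z 0 ?E ?E 0 (0\<^sub>m 0 0)"
    unfolding hermitian_lift_def
    by (intro conjI exI[of _ "\<lambda>_. 0\<^sub>v 0"])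
      (auto simp: carrier_vec_0 bij_betw_def scalar_prod_def field_trace_0[OF z] inj_on_def)
  moreover have "(1 :: complex) = (-1) ^ (0 * (0 - 1) div 2) * det (0\<^sub>m 0 0)" by simp
  moreover have "?A \<in> carrier_mat n n" using V by simp
  ultimately show ?thesis
    unfolding discriminant_of_rank_def using s_equivalent_refl[of ?A] V(2) T by blast
qed

text \<open>\<open>min_poly z\<close> is coprime to \<open>twist_poly n\<close>, which kills the
  isometry. In a Bezout identity evaluated at the isometry, the coefficient of
  \<open>min_poly z\<close> becomes the inverse matrix.\<close>

lemma discriminant_of_rank_twist_nonroot:
  assumes n: "n \<ge> 1" and z: "reciprocal z" and root: "rpoly (twist_poly n) z \<noteq> 0"
    and \<epsilon>: "\<epsilon> = 1 \<or> \<epsilon> = (-1 :: int)"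
  shows "discriminant_of_rank (signed_twist_knot \<epsilon> n) z 0 1"
proof -
  let ?T = "twist_isometry n" and ?p = "min_poly z"
  have "\<not> ?p dvd twist_poly n" using root by (simp add: min_poly_dvd_iff[OF z])
  then have "coprime ?p (twist_poly n)" by (intro prime_elem_imp_coprime min_poly_prime_elem[OF z])
  then obtain a b where ab: "a * ?p + b * twist_poly n = 1"
    using bezout_coefficients_fst_snd[of ?p "twist_poly n"] by auto
  have T: "?T \<in> carrier_mat 2 2" by simp
  note C = mat_poly_carrier[OF T]
  have "mat_poly (a * ?p + b * twist_poly n) ?T = mat_poly a ?T * mat_poly ?p ?T + mat_poly b ?T * 0\<^sub>m 2 2"
    by (simp only: mat_poly_add[OF T] mat_poly_mult[OF T] mat_poly_twist_poly)
  then have "mat_poly a ?T * mat_poly ?p ?T = 1\<^sub>m 2"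
    unfolding ab mat_poly_1[OF T] right_mult_zero_mat[OF C] right_add_zero_mat[OF mult_carrier_mat[OF C C]] by simp
  then show ?thesis
    using n \<epsilon> by (intro discriminant_of_rank_trivial[OF z _ _ T twist_isometry_eq[OF n] C])
      (auto simp: signed_twist_knot_mat2 mat2_map mat2_det)
qed


subsection \<open>Signature jumps of multiples of twist knots\<close>

text \<open>The matrix whose signature is taken in \<open>signature_function\<close>, named in order
  to split it along block sums.\<close>

definition seifert_hermitian :: "int mat \<Rightarrow> complex \<Rightarrow> complex mat" where
  "seifert_hermitian V w =
     (1 - w) \<cdot>\<^sub>m map_mat of_int V + (1 - cnj w) \<cdot>\<^sub>m map_mat of_int (transpose_mat V)"

lemma seifert_hermitian_dsum:
  assumes "V \<in> carrier_mat k k" "W \<in> carrier_mat l l"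
  shows "seifert_hermitian (V \<boxplus> W) w = seifert_hermitian V w \<boxplus> seifert_hermitian W w"
  unfolding seifert_hermitian_def using assms
  by (simp add: transpose_dsum map_mat_dsum smult_dsum add_dsum)

lemma char_poly_dsum:
  fixes A B :: "'a::idom mat"
  assumes "A \<in> carrier_mat k k" "B \<in> carrier_mat l l"
  shows "char_poly (A \<boxplus> B) = char_poly A * char_poly B"
proof -
  have "char_poly_matrix (A \<boxplus> B) = char_poly_matrix A \<boxplus> char_poly_matrix B"
    unfolding char_poly_matrix_def using assms
    by (simp add: map_mat_dsum smult_dsum add_dsum flip: dsum_one)
  then show ?thesis
    using assms by (simp add: char_poly_def det_dsum[of _ k _ l])
qed

lemma connected_sum_Nil: "connected_sum [] = 0\<^sub>m 0 0"
  by (simp add: connected_sum_def)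

lemma connected_sum_Cons: "connected_sum (V # Vs) = V \<boxplus> connected_sum Vs"
  by (simp only: connected_sum_def diag_block_mat_Cons_dsum)

lemma connected_sum_append: "connected_sum (Vs @ Ws) = connected_sum Vs \<boxplus> connected_sum Ws"
  by (simp only: connected_sum_def diag_block_mat_append_dsum)

lemma char_poly_replicate:
  assumes U: "U \<in> carrier_mat l l"
  shows "\<exists>k. connected_sum (replicate c U) \<in> carrier_mat k k \<and>
    char_poly (seifert_hermitian (connected_sum (replicate c U)) w) = char_poly (seifert_hermitian U w) ^ c"
proof (induction c)
  case 0
  have "char_poly (seifert_hermitian (0\<^sub>m 0 0) w) = 1"
    by (simp add: char_poly_def char_poly_matrix_def seifert_hermitian_def)
  then show ?case by (auto simp: connected_sum_Nil intro!: exI[of _ 0])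
next
  case (Suc c)
  then obtain k where k: "connected_sum (replicate c U) \<in> carrier_mat k k"
    "char_poly (seifert_hermitian (connected_sum (replicate c U)) w) = char_poly (seifert_hermitian U w) ^ c"
    by blast
  have "seifert_hermitian V w \<in> carrier_mat m m" if "V \<in> carrier_mat m m" for V m
    using that by (auto simp: seifert_hermitian_def)
  note C = this[OF U] this[OF k(1)]
  show ?case
    using char_poly_dsum[OF C] k dsum_carrier[OF U k(1)]
    by (auto simp: connected_sum_Cons seifert_hermitian_dsum[OF U k(1)])
qed

text \<open>Either a and b have opposite signs and the same multiplicity c, so the two counts
  cancel, or all eigenvalues are 0 and both counts are empty.\<close>

lemma hermitian_signature_balanced:
  fixes a b :: real
  assumes H: "H \<in> carrier_mat k k"
    and char: "char_poly H = ([:- of_real a, 1:] * [:- of_real b, 1:]) ^ c"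
    and ab: "a > 0 \<and> b < 0 \<or> a = 0 \<and> b = 0"
  shows "hermitian_signature H = 0"
proof -
  have ev: "eigenvalue H (complex_of_real x) \<longleftrightarrow> c > 0 \<and> (x = a \<or> x = b)" for x
  proof -
    have "eigenvalue H (complex_of_real x) \<longleftrightarrow>
        ((complex_of_real x - of_real a) * (complex_of_real x - of_real b)) ^ c = 0"
      unfolding eigenvalue_root_char_poly[OF H] char by (simp add: poly_power algebra_simps)
    then show ?thesis by auto
  qed
  have order: "Polynomial.order (complex_of_real x) (char_poly H) = c" if "a \<noteq> b" "x = a \<or> x = b" for x
  proof -
    have [simp]: "Polynomial.order (complex_of_real s) ([:- of_real t, 1:] ^ c) = 0" if "s \<noteq> t" for s t
      using that by (intro order_0I) (simp add: poly_power)
    show ?thesis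
      unfolding char power_mult_distrib using that
      by (subst order_mult) (auto simp: order_power_n_n)
  qed
  show ?thesis
  proof (cases "c > 0 \<and> a > 0")
    case True
    then have "{x. x > 0 \<and> eigenvalue H (complex_of_real x)} = {a}"
      "{x. x < 0 \<and> eigenvalue H (complex_of_real x)} = {b}" using ab ev by auto
    then show ?thesis unfolding hermitian_signature_def using True ab by (simp add: order)
  next
    case False
    then have "{x. x > 0 \<and> eigenvalue H (complex_of_real x)} = {}"
      "{x. x < 0 \<and> eigenvalue H (complex_of_real x)} = {}" using ab ev by auto
    then show ?thesis unfolding hermitian_signature_def by (simp only: sum.empty diff_self)
  qed
qed

lemma char_poly_mat2: "char_poly (mat2 a b c d) = [:a * d - b * c, - (a + d), 1 :: 'a::comm_ring_1:]"
proof -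
  have "char_poly_matrix (mat2 a b c d) = mat2 [:- a, 1:] [:- b:] [:- c:] [:- d, 1:]"
    unfolding char_poly_matrix_def by (simp add: mat2_simps)
  then show ?thesis by (simp add: char_poly_def mat2_det algebra_simps)
qed

text \<open>The determinant of the form is \<open>- n s\<^sup>2 - |1 - w|\<^sup>2\<close> with \<open>s = 2 - 2 Re w\<close>, so the form is
  either indefinite or zero.\<close>

lemma char_poly_seifert_twist:
  assumes \<epsilon>: "\<epsilon> = 1 \<or> \<epsilon> = (-1 :: int)"
  obtains a b :: real where "a > 0 \<and> b < 0 \<or> a = 0 \<and> b = 0"
    "char_poly (seifert_hermitian (signed_twist_knot \<epsilon> n) w) = [:- of_real a, 1:] * [:- of_real b, 1:]"
proof -
  define s where "s = 2 - 2 * Re w"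
  define \<tau> where "\<tau> = of_int \<epsilon> * (real n - 1) * s"
  define D where "D = real n * s\<^sup>2 + (cmod (1 - w))\<^sup>2"
  \<comment> \<open>The form has trace \<tau> and determinant -D; a and b are the roots of x^2 -
    \<tau> x - D, with product -D.\<close>
  define a where "a = (\<tau> + sqrt (\<tau>\<^sup>2 + 4 * D)) / 2"
  define b where "b = (\<tau> - sqrt (\<tau>\<^sup>2 + 4 * D)) / 2"
  have s: "(1 - w) + (1 - cnj w) = of_real s"
    by (simp add: s_def complex_eq_iff)
  have "seifert_hermitian (signed_twist_knot \<epsilon> n) w =
      mat2 (- of_int \<epsilon> * of_real s) (of_int \<epsilon> * (1 - w)) (of_int \<epsilon> * (1 - cnj w)) (of_int \<epsilon> * of_nat n * of_real s)"
    unfolding seifert_hermitian_def signed_twist_knot_mat2 mat2_simps s[symmetric]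
    by (intro arg_cong4[where f = mat2]) (simp_all add: algebra_simps)
  then have "char_poly (seifert_hermitian (signed_twist_knot \<epsilon> n) w)
      = [:- of_real D, - of_real \<tau>, 1:]"
  proof -
    have "- of_int \<epsilon> * of_real s * (of_int \<epsilon> * of_nat n * of_real s) -
        of_int \<epsilon> * (1 - w) * (of_int \<epsilon> * (1 - cnj w)) =
        (of_int \<epsilon> * of_int \<epsilon>) * - (of_nat n * of_real s * of_real s + (1 - w) * cnj (1 - w))"
      by (simp add: algebra_simps)
    also have "(1 - w) * cnj (1 - w) = of_real ((cmod (1 - w))\<^sup>2)"
      by (rule complex_norm_square[symmetric])
    also have "of_int \<epsilon> * of_int \<epsilon> = (1 :: complex)" using \<epsilon> by auto
    finally have det: "- of_int \<epsilon> * of_real s * (of_int \<epsilon> * of_nat n * of_real s) -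
        of_int \<epsilon> * (1 - w) * (of_int \<epsilon> * (1 - cnj w)) = - of_real D"
      by (simp add: D_def power2_eq_square)
    have tr: "- of_int \<epsilon> * of_real s + of_int \<epsilon> * of_nat n * of_real s = complex_of_real \<tau>"
      by (simp add: \<tau>_def algebra_simps)
    show ?thesis using \<open>seifert_hermitian _ w = _\<close> by (simp only: char_poly_mat2 det tr)
  qed
  moreover have D: "D \<ge> 0" by (simp add: D_def)
  moreover have "a * b = - D" "a + b = \<tau>"
    using D by (simp_all add: a_def b_def field_simps power2_eq_square)
  then have D_eq: "D = - (a * b)" and \<tau>_eq: "\<tau> = a + b" by simp_all
  have "[:- complex_of_real a, 1:] * [:- of_real b, 1:] = [:- of_real D, - of_real \<tau>, 1:]"
    unfolding D_eq \<tau>_eq by simp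
  moreover have "a > 0 \<and> b < 0 \<or> a = 0 \<and> b = 0"
  proof (cases "D = 0")
    case True
    \<comment> \<open>D is a sum of two nonnegative terms, so D = 0 forces w = 1, where the trace
      vanishes too. If D > 0, the square root exceeds the absolute value of \<tau>, which separates
      the signs of a and b.\<close>
    then have "1 - w = 0" unfolding D_def by (metis add_nonneg_eq_0_iff mult_nonneg_nonneg
      norm_eq_zero of_nat_0_le_iff power2_eq_square zero_eq_power2 zero_le_power2)
    then have "\<tau> = 0" by (simp add: \<tau>_def s_def)
    then show ?thesis using True by (simp add: a_def b_def)
  next
    case False
    then have "\<bar>\<tau>\<bar> < sqrt (\<tau>\<^sup>2 + 4 * D)"
      using D by (intro real_less_rsqrt) simp
    then have "0 < \<tau> + sqrt (\<tau>\<^sup>2 + 4 * D) \<and> \<tau> - sqrt (\<tau>\<^sup>2 + 4 * D) < 0" by linarith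
    then show ?thesis by (simp add: a_def b_def)
  qed
  ultimately show ?thesis using that by metis
qed

lemma knot_multiple_twist:
  "knot_multiple c (twist_knot n) =
    connected_sum (replicate (nat \<bar>c\<bar>) (signed_twist_knot (if c \<ge> 0 then 1 else -1) n))"
  unfolding knot_multiple_def twist_knot_signed(2) by (simp add: twist_knot_signed(1))

lemma signature_function_knot_multiple:
  "signature_function (knot_multiple c (twist_knot n)) w = 0"
proof -
  define \<epsilon> :: int where "\<epsilon> = (if c \<ge> 0 then 1 else -1)"
  have \<epsilon>: "\<epsilon> = 1 \<or> \<epsilon> = -1"
    "knot_multiple c (twist_knot n) = connected_sum (replicate (nat \<bar>c\<bar>) (signed_twist_knot \<epsilon> n))"
    by (simp_all add: \<epsilon>_def knot_multiple_twist)
  have U: "signed_twist_knot \<epsilon> n \<in> carrier_mat 2 2" by (simp add: signed_twist_knot_mat2)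
  obtain k where k: "knot_multiple c (twist_knot n) \<in> carrier_mat k k"
    "char_poly (seifert_hermitian (knot_multiple c (twist_knot n)) w)
      = char_poly (seifert_hermitian (signed_twist_knot \<epsilon> n) w) ^ nat \<bar>c\<bar>"
    unfolding \<epsilon>(2) using char_poly_replicate[OF U] by blast
  obtain a b :: real where ab: "a > 0 \<and> b < 0 \<or> a = 0 \<and> b = 0"
    "char_poly (seifert_hermitian (signed_twist_knot \<epsilon> n) w) = [:- of_real a, 1:] * [:- of_real b, 1:]"
    using char_poly_seifert_twist[OF \<epsilon>(1)] by blast
  have "seifert_hermitian (knot_multiple c (twist_knot n)) w \<in> carrier_mat k k"
    using k(1) by (auto simp: seifert_hermitian_def)
  from hermitian_signature_balanced[OF this k(2)[unfolded ab(2)] ab(1)]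
  show ?thesis by (simp add: signature_function_def seifert_hermitian_def)
qed

text \<open>Both one-sided limits are limits of the constant 0.\<close>

lemma s_inv_knot_multiple: "s_inv (knot_multiple c (twist_knot n)) z = 0"
  by (simp add: s_inv_def signature_function_knot_multiple tendsto_Lim[OF trivial_limit_at_right_real tendsto_const]
      tendsto_Lim[OF trivial_limit_at_left_real tendsto_const])


subsection \<open>Alexander polynomials and standard discriminants\<close>

text \<open>The determinant inside \<open>alexander_poly\<close> before a power of t is divided out;
  in this form it is plainly multiplicative on block sums.\<close>

definition seifert_poly :: "int mat \<Rightarrow> int poly" where
  "seifert_poly V = det (map_mat (\<lambda>x. [:x:]) V - [:0, 1:] \<cdot>\<^sub>m map_mat (\<lambda>x. [:x:]) (transpose_mat V))"

lemma seifert_poly_dsum: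
  assumes "V \<in> carrier_mat k k" "W \<in> carrier_mat l l"
  shows "seifert_poly (V \<boxplus> W) = seifert_poly V * seifert_poly W"
proof -
  have "seifert_poly (V \<boxplus> W) =
      det ((map_mat (\<lambda>x. [:x:]) V - [:0, 1:] \<cdot>\<^sub>m map_mat (\<lambda>x. [:x:]) (transpose_mat V)) \<boxplus>
        (map_mat (\<lambda>x. [:x:]) W - [:0, 1:] \<cdot>\<^sub>m map_mat (\<lambda>x. [:x:]) (transpose_mat W)))"
    unfolding seifert_poly_def using assms
    by (simp add: transpose_dsum map_mat_dsum smult_dsum minus_dsum)
  also have "\<dots> = seifert_poly V * seifert_poly W"
    unfolding seifert_poly_def by (rule det_dsum[of _ k _ l]) (use assms in auto)
  finally show ?thesis .
qed

lemma seifert_poly_twist: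
  assumes "\<epsilon> = 1 \<or> \<epsilon> = -1"
  shows "seifert_poly (signed_twist_knot \<epsilon> n) = [:- int n, 2 * int n + 1, - int n:]"
  using assms by (auto simp: seifert_poly_def signed_twist_knot_mat2 mat2_simps)

text \<open>Collects properties at z that pass to block sums. The multiplicity of
  \<open>min_poly z\<close> and the rank of one explicit Hermitian form share the number r: for
  twist knots this is a computation, and both numbers are additive.\<close>

definition standard_at :: "complex \<Rightarrow> int mat \<Rightarrow> nat \<Rightarrow> bool" where
  "standard_at z V r \<longleftrightarrow> square_mat V \<and> poly (seifert_poly V) 0 \<noteq> 0 \<and>
     multiplicity (min_poly z) (map_poly of_int (seifert_poly V)) = r \<and>
     (\<exists>\<delta>. discriminant_of_rank V z r \<delta>)"

text \<open>With a nonzero constant term, \<open>alexander_poly\<close> divides by t^0 and equals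
  \<open>seifert_poly\<close>.\<close>

lemma standard_at_e_inv:
  assumes "standard_at z V r" shows "e_inv V z = r mod 2"
proof -
  have "Polynomial.order 0 (seifert_poly V) = 0"
    using assms by (intro order_0I) (simp add: standard_at_def)
  then have "alexander_poly V = seifert_poly V"
    unfolding alexander_poly_def seifert_poly_def[symmetric] Let_def by simp
  then show ?thesis using assms by (simp add: e_inv_def standard_at_def)
qed

context
  fixes z :: complex
  assumes z: "reciprocal z"
begin

lemma standard_at_dsum:
  assumes "standard_at z V r" "standard_at z W s"
  shows "standard_at z (V \<boxplus> W) (r + s)"
proof -
  have V: "V \<in> carrier_mat (dim_row V) (dim_row V)" and W: "W \<in> carrier_mat (dim_row W) (dim_row W)"
    using assms by (auto simp: standard_at_def)
  have nz: "map_poly rat_of_int (seifert_poly V) \<noteq> 0" "map_poly rat_of_int (seifert_poly W) \<noteq> 0"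
    using assms by (auto simp: standard_at_def)
  have "multiplicity (min_poly z) (map_poly of_int (seifert_poly (V \<boxplus> W))) = r + s"
    unfolding seifert_poly_dsum[OF V W] of_int_poly_hom.hom_mult
    using assms by (simp add: prime_elem_multiplicity_mult_distrib[OF min_poly_prime_elem[OF z] nz] standard_at_def)
  moreover obtain \<delta> \<epsilon> where "discriminant_of_rank V z r \<delta>" "discriminant_of_rank W z s \<epsilon>"
    using assms by (auto simp: standard_at_def)
  then have "discriminant_of_rank (V \<boxplus> W) z (r + s) ((-1) ^ (r * s) * \<delta> * \<epsilon>)"
    by (rule discriminant_of_rank_dsum[OF z _ _ V W])
  ultimately show ?thesis
    unfolding standard_at_def using assms
    by (intro conjI exI) (auto simp: standard_at_def seifert_poly_dsum[OF V W])
qed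

lemma standard_at_empty: "standard_at z (0\<^sub>m 0 0) 0"
proof -
  have "discriminant_of_rank (0\<^sub>m 0 0) z 0 1"
    by (rule discriminant_of_rank_trivial[OF z, of _ 0 "0\<^sub>m 0 0" "0\<^sub>m 0 0"]) auto
  moreover have "seifert_poly (0\<^sub>m 0 0) = 1"
    unfolding seifert_poly_def by (rule det_dim_zero) auto
  ultimately show ?thesis by (auto simp: standard_at_def)
qed

definition twist_rank :: "nat \<Rightarrow> nat" where
  "twist_rank n = (if rpoly (twist_poly n) z = 0 then 1 else 0)"

text \<open>For either sign the determinant is -n times \<open>twist_poly n\<close>, and -n is a
  unit over Q. At a root, \<open>twist_poly n\<close> is the prime \<open>min_poly z\<close> itself,
  of multiplicity 1.\<close>

lemma standard_at_twist:
  assumes n: "n \<ge> 1" and \<epsilon>: "\<epsilon> = 1 \<or> \<epsilon> = -1"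
  shows "standard_at z (signed_twist_knot \<epsilon> n) (twist_rank n)"
proof -
  let ?p = "min_poly z"
  have "map_poly rat_of_int [:- int n, 2 * int n + 1, - int n:] = [:- of_nat n:] * twist_poly n"
    using n by (simp add: twist_poly_def algebra_simps of_int_hom.map_poly_pCons_hom)
  moreover have "is_unit [:- of_nat n :: rat:]" using n by (simp add: is_unit_pCons_iff)
  ultimately have "multiplicity ?p (map_poly of_int [:- int n, 2 * int n + 1, - int n:])
      = multiplicity ?p (twist_poly n)"
    by (simp only: multiplicity_times_unit_right)
  also have "\<dots> = twist_rank n"
  proof (cases "rpoly (twist_poly n) z = 0")
    case True
    then show ?thesis
      using multiplicity_prime[OF min_poly_prime_elem[OF z]] min_poly_twist[OF n z]
      by (simp add: twist_rank_def)
  next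
    case False
    then show ?thesis by (simp add: twist_rank_def not_dvd_imp_multiplicity_0 min_poly_dvd_iff[OF z])
  qed
  finally have "multiplicity ?p (map_poly of_int [:- int n, 2 * int n + 1, - int n:]) = twist_rank n" .
  moreover have "square_mat (signed_twist_knot \<epsilon> n)" by (simp add: signed_twist_knot_mat2)
  ultimately show ?thesis
    using n discriminant_of_rank_twist_root[OF n z _ \<epsilon>] discriminant_of_rank_twist_nonroot[OF n z _ \<epsilon>]
    by (auto simp: standard_at_def seifert_poly_twist[OF \<epsilon>] twist_rank_def)
qed

lemma standard_at_connected_sum:
  assumes "\<And>x. x \<in> set xs \<Longrightarrow> standard_at z (f x) (g x)"
  shows "standard_at z (connected_sum (map f xs)) (sum_list (map g xs))"
  using assms
proof (induction xs)
  case Nil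
  then show ?case by (simp add: connected_sum_Nil standard_at_empty)
next
  case (Cons x xs)
  then show ?case by (simp add: connected_sum_Cons standard_at_dsum)
qed

lemma standard_at_knot_multiple:
  assumes "n \<ge> 1"
  shows "standard_at z (knot_multiple c (twist_knot n)) (nat \<bar>c\<bar> * twist_rank n)"
proof -
  let ?V = "signed_twist_knot (if c \<ge> 0 then 1 else -1) n"
  \<comment> \<open>A list of units indexes the copies, which presents the multiple as a mapped
    list.\<close>
  have "standard_at z (connected_sum (map (\<lambda>_. ?V) (replicate (nat \<bar>c\<bar>) ())))
      (sum_list (map (\<lambda>_. twist_rank n) (replicate (nat \<bar>c\<bar>) ())))"
    by (rule standard_at_connected_sum) (use standard_at_twist[OF assms] in auto)
  then show ?thesis by (simp add: knot_multiple_twist sum_list_replicate)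
qed

text \<open>With \<open>v = 0\<close> or \<open>a = b = 0\<close>, the sum \<open>a + b\<close> is even in either case, so that all
  discriminants of \<open>V\<close> are those of the sum up to one factor \<open>\<kappa>\<close>, and \<open>\<kappa>\<close> is itself a norm.  This
  needs no well-definedness of the discriminant.\<close>

lemma invariants_of_summand:
  assumes X: "standard_at z X a" and V: "standard_at z V v" and Y: "standard_at z Y b"
    and e: "e_inv (X \<boxplus> (V \<boxplus> Y)) z = 0" and d: "d_inv (X \<boxplus> (V \<boxplus> Y)) z = norm_group z"
    and va: "v = 0 \<or> a = 0 \<and> b = 0"
  shows "e_inv V z = 0 \<and> d_inv V z = norm_group z"
proof -
  let ?W = "X \<boxplus> (V \<boxplus> Y)"
  have "e_inv ?W z = (a + (v + b)) mod 2"
    by (intro standard_at_e_inv standard_at_dsum X V Y)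
  \<comment> \<open>The total a + v + b is even. One of v and a + b is 0, so the other one has this
    parity.\<close>
  then have even: "even v" "even (a + b)" using e va by auto
  have Xc: "X \<in> carrier_mat (dim_row X) (dim_row X)" and Vc: "V \<in> carrier_mat (dim_row V) (dim_row V)"
    and Yc: "Y \<in> carrier_mat (dim_row Y) (dim_row Y)"
    using X V Y by (auto simp: standard_at_def)
  obtain \<alpha> \<beta> \<gamma> where \<alpha>: "discriminant_of_rank X z a \<alpha>" and \<beta>: "discriminant_of_rank Y z b \<beta>"
    and \<gamma>: "discriminant_of_rank V z v \<gamma>"
    using X V Y by (auto simp: standard_at_def)
  define \<kappa> where "\<kappa> = (-1) ^ (a * b) * \<alpha> * \<beta>"
  have sum: "\<kappa> * \<delta> \<in> norm_group z" if "discriminant_of_rank V z r \<delta>" for r \<delta>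
  proof -
    have "discriminant_of_rank ?W z (a + (r + b)) ((-1) ^ (a * (r + b)) * \<alpha> * ((-1) ^ (r * b) * \<delta> * \<beta>))"
      by (rule discriminant_of_rank_dsum[OF z \<alpha> discriminant_of_rank_dsum[OF z that \<beta> Vc Yc] Xc dsum_carrier[OF Vc Yc]])
    moreover have "(-1) ^ (a * (r + b)) * (-1) ^ (r * b) = ((-1) ^ (a * b) :: complex)"
    proof -
      \<comment> \<open>Isolates the unknown rank r: it occurs only in r (a + b), which is
        even.\<close>
      have "a * (r + b) + r * b = a * b + r * (a + b)" by (simp add: algebra_simps)
      then have "(-1) ^ (a * (r + b)) * (-1) ^ (r * b) = ((-1) ^ (a * b + r * (a + b)) :: complex)"
        by (simp only: flip: power_add)
      then show ?thesis using even(2) by (simp add: power_add)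
    qed
    then have "(-1) ^ (a * (r + b)) * \<alpha> * ((-1) ^ (r * b) * \<delta> * \<beta>) = \<kappa> * \<delta>"
      unfolding \<kappa>_def by (metis (no_types, lifting) mult.assoc mult.commute mult.left_commute)
    ultimately have "discriminant_of ?W z (\<kappa> * \<delta>)" by (auto simp: discriminant_of_iff_rank)
    then have "\<kappa> * \<delta> * 1 \<in> d_inv ?W z" unfolding d_inv_def using one_in_norm_group[OF z] by blast
    then show ?thesis by (simp add: d)
  qed
  \<comment> \<open>If v = 0, then V has the empty discriminant 1 and \<kappa> is a discriminant of
    the whole sum. If a = b = 0, then \<kappa> = 1.\<close>
  have "\<kappa> \<in> norm_group z"
    using va
  proof
    assume "v = 0"
    then have "\<gamma> = 1" using \<gamma> discriminant_of_rank_0 by simp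
    then show ?thesis using sum[OF \<gamma>] by simp
  next
    assume ab: "a = 0 \<and> b = 0"
    then have "\<alpha> = 1" "\<beta> = 1" using \<alpha> \<beta> discriminant_of_rank_0 by auto
    then show ?thesis using ab by (simp add: \<kappa>_def one_in_norm_group[OF z])
  qed
  then have norm: "\<delta> \<in> norm_group z" if "discriminant_of V z \<delta>" for \<delta>
    using that sum norm_group_divide[OF z, of "\<kappa> * \<delta>" \<kappa>] norm_group_nonzero[OF z, of \<kappa>]
    by (auto simp: discriminant_of_iff_rank)
  have \<gamma>': "discriminant_of V z \<gamma>" using \<gamma> by (auto simp: discriminant_of_iff_rank)
  \<comment> \<open>Equality also takes one existing discriminant, here \<gamma>: without it
    \<open>d_inv\<close> would be empty.\<close>
  have "d_inv V z = norm_group z"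
  proof (intro equalityI subsetI)
    fix x assume "x \<in> d_inv V z"
    then show "x \<in> norm_group z" using norm norm_group_mult[OF z] by (auto simp: d_inv_def)
  next
    fix x assume x: "x \<in> norm_group z"
    have "x = \<gamma> * (x / \<gamma>)" using norm_group_nonzero[OF z norm[OF \<gamma>']] by simp
    then show "x \<in> d_inv V z"
      unfolding d_inv_def using \<gamma>' norm_group_divide[OF z x norm[OF \<gamma>']] by blast
  qed
  then show ?thesis using standard_at_e_inv[OF V] even(1) by auto
qed

lemma twist_rank_unique:
  "m \<ge> 1 \<Longrightarrow> n \<ge> 1 \<Longrightarrow> m \<noteq> n \<Longrightarrow> twist_rank m = 0 \<or> twist_rank n = 0"
  using twist_poly_root_unique[of m z n] by (auto simp: twist_rank_def)

end

theorem corollary3p2: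
  fixes c :: "nat \<Rightarrow> int" and m :: nat
  assumes "rationally_algebraically_slice
             (connected_sum (map (\<lambda>j. knot_multiple (c j) (twist_knot j)) [1..<Suc m]))"
  shows "\<forall>j\<in>{1..m}. rationally_algebraically_slice (knot_multiple (c j) (twist_knot j))"
proof
  fix j assume j: "j \<in> {1..m}"
  let ?K = "\<lambda>j. knot_multiple (c j) (twist_knot j)"
  let ?X = "connected_sum (map ?K [1..<j])" and ?Y = "connected_sum (map ?K [Suc j..<Suc m])"
  have "[1..<Suc m] = [1..<j] @ [j..<Suc m]"
    using j by (metis atLeastAtMost_iff le_SucI le_add_diff_inverse upt_add_eq_append)
  also have "[j..<Suc m] = j # [Suc j..<Suc m]"
    using j by (intro upt_conv_Cons) auto
  finally have W: "connected_sum (map ?K [1..<Suc m]) = ?X \<boxplus> (?K j \<boxplus> ?Y)"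
    by (simp only: list.map map_append connected_sum_append connected_sum_Cons)
  have "e_inv (?K j) z = 0 \<and> d_inv (?K j) z = norm_group z"
    if "b \<in> P_seq" "k \<ge> 1" "z = b k" for b k z
  proof -
    have z: "reciprocal z" using that by (auto simp: P_seq_def)
    \<comment> \<open>Index 0 is excluded because the 0-twist matrix has a
      \<open>seifert_poly\<close> with constant term 0.\<close>
    have std: "standard_at z (connected_sum (map ?K js)) (\<Sum>j\<leftarrow>js. nat \<bar>c j\<bar> * twist_rank z j)"
      if "\<forall>j\<in>set js. j \<ge> 1" for js
      using that by (intro standard_at_connected_sum[OF z] standard_at_knot_multiple[OF z]) auto
    \<comment> \<open>A nonzero rank of T_j means that z is a root of its polynomial, hence of no
      other one, and all terms in both remaining ranges vanish.\<close>
    have rank: "nat \<bar>c j\<bar> * twist_rank z j = 0 \<or>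
        (\<Sum>j\<leftarrow>[1..<j]. nat \<bar>c j\<bar> * twist_rank z j) = 0 \<and>
        (\<Sum>j\<leftarrow>[Suc j..<Suc m]. nat \<bar>c j\<bar> * twist_rank z j) = 0"
    proof (cases "twist_rank z j = 0")
      case False
      then have "twist_rank z i = 0" if "i \<ge> 1" "i \<noteq> j" for i
        using twist_rank_unique[OF z that(1), of j] that(2) j by auto
      then show ?thesis by (auto simp: sum_list_eq_0_iff)
    qed simp
    have slice: "e_inv (?X \<boxplus> (?K j \<boxplus> ?Y)) z = 0" "d_inv (?X \<boxplus> (?K j \<boxplus> ?Y)) z = norm_group z"
      using assms that(1,2) unfolding W rationally_algebraically_slice_def that(3) by blast+
    have "standard_at z ?X (\<Sum>j\<leftarrow>[1..<j]. nat \<bar>c j\<bar> * twist_rank z j)"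
      "standard_at z (?K j) (nat \<bar>c j\<bar> * twist_rank z j)"
      "standard_at z ?Y (\<Sum>j\<leftarrow>[Suc j..<Suc m]. nat \<bar>c j\<bar> * twist_rank z j)"
      by (rule std standard_at_knot_multiple[OF z]; use j in auto)+
    from invariants_of_summand[OF z this slice rank] show ?thesis .
  qed
  then show "rationally_algebraically_slice (?K j)"
    unfolding rationally_algebraically_slice_def by (auto simp: s_inv_knot_multiple)
qed

end
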